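(* Let $\alpha,\beta\in CBV^*[0,1]$ and $v,w\in CBV[0,1]$ satisfy $v(t)+w(t)=1$ for all $t\in[0,1]$ and $\|\alpha\|+\|\alpha-\beta\|\cdot\|w\|_{BV}<1$. Let $p\in(1,+\infty]$, $q\in[1,+\infty)$ with $p^{-1}+q^{-1}=1$. Let $f\colon[0,1]\times\mathbb R\to\mathbb R$ satisfy: $t\mapsto f(t,u)$ is Lebesgue measurable for every $u$; $u\mapsto f(t,u)$ is continuous for a.e. $t$; there exist a non-decreasing $\psi\colon[0,+\infty)\to[0,+\infty)$ and $\phi\in L^p([0,1])$, $\phi\ge0$, with $|f(t,u)|\le\phi(t)\psi(|u|)$ for all $t,u$; and $\lim_{r\to+\infty}\psi(r)/r=0$. Let $k\colon[0,1]^2\to\mathbb R$ satisfy: $s\mapsto k(t,s)$ is in $L^q([0,1])$ for every $t$; there is $m\in L^q([0,1])$, $m\ge0$, with $\operatorname{var}_{[0,1]}k(\cdot,s)\le m(s)$ for a.e. $s$; and $\lim_{t\to\tau}\int_0^1|k(t,s)-k(\tau,s)|\phi(s)\,ds=0$ for every $\tau\in[0,1]$. Then the equation $x(t)=\alpha[x]v(t)+\beta[x]w(t)+\int_0^1k(t,s)f(s,x(s))\,ds$, $t\in[0,1]$, has a solution $x\in CBV[0,1]$.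
   Context: $BV[0,1]$ is the Banach space of real functions of bounded Jordan variation on $[0,1]$ with norm $\|f\|_{BV}=|f(0)|+\operatorname{var}_{[0,1]}f$; $CBV[0,1]$ is its closed subspace of continuous functions, and $CBV^*[0,1]$ its dual with the operator norm $\|\cdot\|$. *)

theory Defs
  imports "HOL-Analysis.Analysis"
begin

definition partition_sum :: "(real \<Rightarrow> real) \<Rightarrow> real list \<Rightarrow> real" where
  "partition_sum f xs = (\<Sum>i<length xs - 1. \<bar>f (xs ! Suc i) - f (xs ! i)\<bar>)"

definition partitions :: "real \<Rightarrow> real \<Rightarrow> real list set" where
  "partitions a b = {xs. sorted xs \<and> set xs \<subseteq> {a..b}}"

definition bounded_variation :: "(real \<Rightarrow> real) \<Rightarrow> real \<Rightarrow> real \<Rightarrow> bool" where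
  "bounded_variation f a b \<longleftrightarrow> (\<exists>B. \<forall>xs\<in>partitions a b. partition_sum f xs \<le> B)"

text \<open>Total (Jordan) variation on [a,b] (meaningful when f has bounded variation).\<close>
definition total_variation :: "(real \<Rightarrow> real) \<Rightarrow> real \<Rightarrow> real \<Rightarrow> real" where
  "total_variation f a b = (SUP xs\<in>partitions a b. partition_sum f xs)"

definition BV_norm :: "(real \<Rightarrow> real) \<Rightarrow> real" where
  "BV_norm f = \<bar>f 0\<bar> + total_variation f 0 1"

text \<open>CBV[0,1]: continuous functions of bounded variation on [0,1]; functions are
  normalised to vanish outside [0,1] so that each element has a unique representative.\<close>
definition CBV :: "(real \<Rightarrow> real) set" where
  "CBV = {x. continuous_on {0..1} x \<and> bounded_variation x 0 1 \<and> (\<forall>t. t \<notin> {0..1} \<longrightarrow> x t = 0)}"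

definition CBV_dual :: "((real \<Rightarrow> real) \<Rightarrow> real) set" where
  "CBV_dual = {\<alpha>. (\<forall>x\<in>CBV. \<forall>y\<in>CBV. \<alpha> (\<lambda>t. x t + y t) = \<alpha> x + \<alpha> y)
     \<and> (\<forall>c. \<forall>x\<in>CBV. \<alpha> (\<lambda>t. c * x t) = c * \<alpha> x)
     \<and> (\<exists>C. \<forall>x\<in>CBV. \<bar>\<alpha> x\<bar> \<le> C * BV_norm x)}"

definition dual_norm :: "((real \<Rightarrow> real) \<Rightarrow> real) \<Rightarrow> real" where
  "dual_norm \<alpha> = (SUP x\<in>{x\<in>CBV. BV_norm x \<le> 1}. \<bar>\<alpha> x\<bar>)"

definition memLp :: "ereal \<Rightarrow> (real \<Rightarrow> real) \<Rightarrow> bool" where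
  "memLp p f \<longleftrightarrow> f \<in> borel_measurable (lebesgue_on {0..1}) \<and>
     (if p = \<infinity> then (\<exists>C. AE t in lebesgue_on {0..1}. \<bar>f t\<bar> \<le> C)
      else integrable (lebesgue_on {0..1}) (\<lambda>t. \<bar>f t\<bar> powr real_of_ereal p))"

end

theory Submission
  imports Defs "HOL-Complex_Analysis.Great_Picard"
begin

text \<open>
  Since v = 1 - w on [0,1], the equation reads x = \<alpha>[x] 1 + (\<beta> - \<alpha>)[x] w + K f(\<cdot>, x), where K is the
  integral operator with kernel k. The functionals are continuous for the BV norm only, whereas compactness
  is available only for uniform convergence. The fixed point problem is therefore posed for the triple
  (a, b, y) of the values of the two functionals and the integral term, y being a mere continuous function:
  with x = a 1 + b w + y, the new integral term is K f(\<cdot>, x). If y converges uniformly, then by dominated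
  convergence f(\<cdot>, x) converges in the L1 space with weight |k(0,\<cdot>)| + m, and this weighted norm controls
  the BV norm of the image under K; so the new values of the functionals depend continuously on (a, b, y).
  The smallness condition and the sublinear growth of \<psi> provide an invariant box, the images under K are
  equicontinuous by the continuity condition on k, and Schauder's theorem applies.
\<close>

section \<open>Fixed points in the Hilbert cube and Schauder's theorem\<close>

lemma LIMSEQ_inverse_Suc_subseq:
  assumes "strict_mono r" shows "(\<lambda>n. 1 / real (Suc (r n))) \<longlonglongrightarrow> 0"
  using LIMSEQ_subseq_LIMSEQ[OF LIMSEQ_inverse_real_of_nat assms] by (simp add: o_def inverse_eq_divide)

lemma tendsto_coordinatewise_iff:
  fixes f :: "'a \<Rightarrow> 'b \<Rightarrow> 'c::topological_space"
  shows "(f \<longlongrightarrow> l) F \<longleftrightarrow> (\<forall>i. ((\<lambda>x. f x i) \<longlongrightarrow> l i) F)"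
  using limitin_componentwise[of "\<lambda>_::'b. euclidean :: 'c topology" UNIV f l F]
  by (simp add: euclidean_product_topology)

lemma tendsto_coordinatewise_close:
  fixes f g :: "'a \<Rightarrow> 'b \<Rightarrow> real"
  assumes g: "(g \<longlongrightarrow> l) F" and r: "(r \<longlongrightarrow> 0) F"
    and close: "\<forall>\<^sub>F x in F. \<forall>i. \<bar>f x i - g x i\<bar> \<le> r x"
  shows "(f \<longlongrightarrow> l) F"
  unfolding tendsto_coordinatewise_iff
proof
  fix i
  have "\<forall>\<^sub>F x in F. norm (f x i - g x i) \<le> r x"
    using close by eventually_elim simp
  then have "((\<lambda>x. f x i - g x i) \<longlongrightarrow> 0) F"
    using r by (rule Lim_null_comparison)
  moreover have "((\<lambda>x. g x i) \<longlongrightarrow> l i) F"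
    using g by (simp add: tendsto_coordinatewise_iff)
  ultimately show "((\<lambda>x. f x i) \<longlongrightarrow> l i) F"
    using tendsto_add by fastforce
qed

definition hilbert_cube :: "(nat \<Rightarrow> real) set" where
  "hilbert_cube = UNIV \<rightarrow> {0..1}"

lemma hilbert_cubeD: "x \<in> hilbert_cube \<Longrightarrow> 0 \<le> x i \<and> x i \<le> 1"
  by (auto simp: hilbert_cube_def)

lemma compact_hilbert_cube: "compact hilbert_cube"
  using compactin_PiE[of "\<lambda>_::nat. euclidean :: real topology" UNIV "\<lambda>_. {0..1}"]
  by (simp add: euclidean_product_topology hilbert_cube_def PiE_UNIV_domain)

definition grid_point :: "nat \<Rightarrow> (nat \<Rightarrow> nat) \<Rightarrow> nat \<Rightarrow> real" where
  "grid_point n a i = (if i < n then real (a i) / real n else 0)"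

definition in_cell :: "nat \<Rightarrow> (nat \<Rightarrow> nat) \<Rightarrow> (nat \<Rightarrow> nat) \<Rightarrow> bool" where
  "in_cell n q a \<longleftrightarrow> (\<forall>i<n. q i \<le> a i \<and> a i \<le> q i + 1)"

lemma grid_point_in_hilbert_cube: "\<forall>i<n. a i \<le> n \<Longrightarrow> grid_point n a \<in> hilbert_cube"
  by (force simp: grid_point_def hilbert_cube_def divide_le_eq_1)

lemma grid_point_in_cell_in_hilbert_cube:
  assumes "\<forall>i<n. q i < n" "in_cell n q a"
  shows "grid_point n a \<in> hilbert_cube"
  using assms by (force simp: in_cell_def intro!: grid_point_in_hilbert_cube)

lemma grid_point_in_cell_close:
  assumes "in_cell n q a"
  shows "\<bar>grid_point n a i - grid_point n q i\<bar> \<le> 1 / real n"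
proof (cases "i < n")
  case True
  then have "\<bar>real (a i) - real (q i)\<bar> \<le> 1"
    using assms by (force simp: in_cell_def)
  then have "\<bar>real (a i) - real (q i)\<bar> / real n \<le> 1 / real n"
    by (rule divide_right_mono) simp
  with True show ?thesis
    by (simp add: grid_point_def flip: diff_divide_distrib)
qed (simp add: grid_point_def)

text \<open>Kuhn's lemma is applied to the first n coordinates, the others being zero. Letting n vary inside
  one space avoids a fixed point theorem whose dimension is a number rather than a type.\<close>

lemma kuhn_sign_changing_cell:
  assumes F: "F \<in> hilbert_cube \<rightarrow> hilbert_cube" and n: "0 < n"
  obtains q where "\<forall>i<n. q i < n"
    and "\<forall>i<n. \<exists>r s. in_cell n q r \<and> in_cell n q s \<and> grid_point n r i \<le> F (grid_point n r) i
      \<and> F (grid_point n s) i \<le> grid_point n s i"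
proof -
  define label where "label x i = (if x i < 1 \<and> x i \<le> F x i then 0 else 1 :: nat)" for x i
  have label_sign: "label x i = 0 \<Longrightarrow> x i \<le> F x i" "label x i = 1 \<Longrightarrow> F x i \<le> x i"
    if "x \<in> hilbert_cube" for x i
    using hilbert_cubeD[OF that, of i] hilbert_cubeD[OF funcset_mem[OF F that], of i]
    by (auto simp: label_def split: if_splits)
  obtain q where q: "\<forall>i<n. q i < n"
    and changes: "\<forall>i<n. \<exists>r s. (\<forall>j<n. q j \<le> r j \<and> r j \<le> q j + 1) \<and> (\<forall>j<n. q j \<le> s j \<and> s j \<le> q j + 1)
         \<and> label (grid_point n r) i \<noteq> label (grid_point n s) i"
  proof (rule kuhn_lemma[OF n, of n "\<lambda>a. label (grid_point n a)"])
    show "\<forall>a. (\<forall>i<n. a i \<le> n) \<longrightarrow> (\<forall>i<n. a i = 0 \<longrightarrow> label (grid_point n a) i = 0)"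
      using hilbert_cubeD[OF funcset_mem[OF F grid_point_in_hilbert_cube]]
      by (simp add: label_def grid_point_def)
    show "\<forall>a. (\<forall>i<n. a i \<le> n) \<longrightarrow> (\<forall>i<n. a i = n \<longrightarrow> label (grid_point n a) i = 1)"
      using n by (simp add: label_def grid_point_def)
  qed (auto simp: label_def)
  have "\<exists>r s. in_cell n q r \<and> in_cell n q s \<and> grid_point n r i \<le> F (grid_point n r) i
      \<and> F (grid_point n s) i \<le> grid_point n s i" if "i < n" for i
  proof -
    obtain r s where cell: "in_cell n q r" "in_cell n q s"
      and "label (grid_point n r) i \<noteq> label (grid_point n s) i"
      using changes \<open>i < n\<close> unfolding in_cell_def by blast
    then consider "label (grid_point n r) i = 0" "label (grid_point n s) i = 1"
      | "label (grid_point n s) i = 0" "label (grid_point n r) i = 1"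
      by (auto simp: label_def split: if_splits)
    then show ?thesis
      using cell label_sign[OF grid_point_in_cell_in_hilbert_cube[OF q]] by cases blast+
  qed
  with q show thesis using that by blast
qed

lemma hilbert_cube_sign_changes:
  assumes "F \<in> hilbert_cube \<rightarrow> hilbert_cube" "0 < n"
  obtains z x y where "z \<in> hilbert_cube"
    and "\<And>i. i < n \<Longrightarrow> x i \<in> hilbert_cube \<and> y i \<in> hilbert_cube"
    and "\<And>i j. i < n \<Longrightarrow> \<bar>x i j - z j\<bar> \<le> 1 / real n \<and> \<bar>y i j - z j\<bar> \<le> 1 / real n"
    and "\<And>i. i < n \<Longrightarrow> x i i \<le> F (x i) i \<and> F (y i) i \<le> y i i"
proof -
  obtain q where q: "\<forall>i<n. q i < n"
    and "\<forall>i<n. \<exists>r s. in_cell n q r \<and> in_cell n q s \<and> grid_point n r i \<le> F (grid_point n r) i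
      \<and> F (grid_point n s) i \<le> grid_point n s i"
    using kuhn_sign_changing_cell[OF assms] by blast
  then obtain r s where cell: "\<And>i. i < n \<Longrightarrow> in_cell n q (r i)" "\<And>i. i < n \<Longrightarrow> in_cell n q (s i)"
    and sign: "\<And>i. i < n \<Longrightarrow> grid_point n (r i) i \<le> F (grid_point n (r i)) i
      \<and> F (grid_point n (s i)) i \<le> grid_point n (s i) i"
    by metis
  show thesis
  proof (rule that)
    show "grid_point n q \<in> hilbert_cube"
      using q by (intro grid_point_in_hilbert_cube) (simp add: less_imp_le)
    show "grid_point n (r i) \<in> hilbert_cube \<and> grid_point n (s i) \<in> hilbert_cube" if "i < n" for i
      using cell[OF that] grid_point_in_cell_in_hilbert_cube[OF q] by blast
    show "\<bar>grid_point n (r i) j - grid_point n q j\<bar> \<le> 1 / real n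
        \<and> \<bar>grid_point n (s i) j - grid_point n q j\<bar> \<le> 1 / real n" if "i < n" for i j
      using cell[OF that] grid_point_in_cell_close by blast
  qed (rule sign)
qed

theorem hilbert_cube_fixed_point:
  assumes F: "F \<in> hilbert_cube \<rightarrow> hilbert_cube" and cont: "continuous_on hilbert_cube F"
  obtains x where "x \<in> hilbert_cube" "F x = x"
proof -
  have "\<exists>z x y. z \<in> hilbert_cube \<and> (\<forall>i\<le>n. (x i \<in> hilbert_cube \<and> y i \<in> hilbert_cube) \<and>
      (\<forall>j. \<bar>x i j - z j\<bar> \<le> 1 / Suc n \<and> \<bar>y i j - z j\<bar> \<le> 1 / Suc n) \<and>
      x i i \<le> F (x i) i \<and> F (y i) i \<le> y i i)" for n
    by (rule hilbert_cube_sign_changes[OF F zero_less_Suc[of n]]) (metis less_Suc_eq_le)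
  then obtain z x y where z: "z n \<in> hilbert_cube"
    and in_cube: "i \<le> n \<Longrightarrow> x n i \<in> hilbert_cube \<and> y n i \<in> hilbert_cube"
    and close: "i \<le> n \<Longrightarrow> \<bar>x n i j - z n j\<bar> \<le> 1 / Suc n \<and> \<bar>y n i j - z n j\<bar> \<le> 1 / Suc n"
    and sign: "i \<le> n \<Longrightarrow> x n i i \<le> F (x n i) i \<and> F (y n i) i \<le> y n i i" for n i j
    by metis
  obtain w \<rho> where w: "w \<in> hilbert_cube" and \<rho>: "strict_mono \<rho>" and z_lim: "(\<lambda>n. z (\<rho> n)) \<longlonglongrightarrow> w"
    using seq_compactE[OF compact_imp_seq_compact[OF compact_hilbert_cube], of z] z
    by (auto simp: o_def)
  have large: "\<forall>\<^sub>F n in sequentially. i \<le> \<rho> n" for i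
    using filterlim_subseq[OF \<rho>] by (simp add: filterlim_at_top)
  have limits: "(\<lambda>n. u (\<rho> n) i) \<longlonglongrightarrow> w i" "(\<lambda>n. F (u (\<rho> n)) i) \<longlonglongrightarrow> F w i"
    if u: "\<And>n. i \<le> n \<Longrightarrow> u n \<in> hilbert_cube" "\<And>n j. i \<le> n \<Longrightarrow> \<bar>u n j - z n j\<bar> \<le> 1 / Suc n" for i u
  proof -
    have "\<forall>\<^sub>F n in sequentially. \<forall>j. \<bar>u (\<rho> n) j - z (\<rho> n) j\<bar> \<le> 1 / Suc (\<rho> n)"
      using large[of i] by (rule eventually_mono) (use u(2) in blast)
    then have lim: "(\<lambda>n. u (\<rho> n)) \<longlonglongrightarrow> w"
      by (rule tendsto_coordinatewise_close[OF z_lim LIMSEQ_inverse_Suc_subseq[OF \<rho>]])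
    have "\<forall>\<^sub>F n in sequentially. u (\<rho> n) \<in> hilbert_cube"
      using large[of i] by (rule eventually_mono) (use u(1) in blast)
    then have "(\<lambda>n. F (u (\<rho> n))) \<longlonglongrightarrow> F w"
      by (rule continuous_on_tendsto_compose[OF cont lim w])
    with lim show "(\<lambda>n. u (\<rho> n) i) \<longlonglongrightarrow> w i" "(\<lambda>n. F (u (\<rho> n)) i) \<longlonglongrightarrow> F w i"
      by (simp_all add: tendsto_coordinatewise_iff)
  qed
  have "F w i = w i" for i
  proof (rule antisym)
    show "w i \<le> F w i"
      by (rule tendsto_le[OF _ limits(2,1)[of i "\<lambda>n. x n i"]])
        (use in_cube close eventually_mono[OF large[of i]] sign in auto)
    show "F w i \<le> w i"
      by (rule tendsto_le[OF _ limits(1,2)[of i "\<lambda>n. y n i"]])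
        (use in_cube close eventually_mono[OF large[of i]] sign in auto)
  qed
  with w that show thesis by blast
qed

lemma compact_finite_net:
  fixes K :: "'a::metric_space set"
  assumes K: "compact K" and e: "0 < e"
  obtains n :: nat and y where "\<And>i. i < n \<Longrightarrow> y i \<in> K" and "\<And>u. u \<in> K \<Longrightarrow> \<exists>i<n. dist (y i) u < e"
proof -
  obtain T where T: "finite T" "T \<subseteq> K" and cover: "K \<subseteq> (\<Union>y\<in>T. ball y e)"
    using compactE_image[OF K, of K "\<lambda>y. ball y e"] e by (metis centre_in_ball open_ball UN_I subsetI)
  obtain y and n :: nat where "bij_betw y {..<n} T"
    using ex_bij_betw_nat_finite[OF T(1)] by (auto simp: atLeast0LessThan)
  then have y: "y ` {..<n} = T"
    by (rule bij_betw_imp_surj_on)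
  show thesis
  proof (rule that)
    show "y i \<in> K" if "i < n" for i
      using T(2) y that by blast
    show "\<exists>i<n. dist (y i) u < e" if "u \<in> K" for u
      using cover that by (fastforce simp flip: y)
  qed
qed

lemma norm_convex_combination_diff_le:
  fixes y :: "'i \<Rightarrow> 'a::real_normed_vector"
  assumes a: "\<And>i. i \<in> I \<Longrightarrow> 0 \<le> a i" "sum a I = 1"
    and near: "\<And>i. i \<in> I \<Longrightarrow> a i \<noteq> 0 \<Longrightarrow> norm (y i - u) \<le> e"
  shows "norm ((\<Sum>i\<in>I. a i *\<^sub>R y i) - u) \<le> e"
proof -
  have "(\<Sum>i\<in>I. a i *\<^sub>R y i) - u = (\<Sum>i\<in>I. a i *\<^sub>R (y i - u))"
    using a(2) by (simp add: scaleR_right_diff_distrib sum_subtractf flip: scaleR_left.sum)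
  also have "norm \<dots> \<le> (\<Sum>i\<in>I. a i * e)"
  proof (rule sum_norm_le)
    fix i assume "i \<in> I"
    then show "norm (a i *\<^sub>R (y i - u)) \<le> a i * e"
      using a(1) near by (cases "a i = 0") (auto intro: mult_left_mono)
  qed
  also have "\<dots> = e"
    using a(2) by (simp flip: sum_distrib_right)
  finally show ?thesis .
qed

lemma schauder_projection:
  fixes K :: "'a::real_normed_vector set"
  assumes K: "compact K" and e: "0 < e"
  obtains n :: nat and y :: "nat \<Rightarrow> 'a" and c :: "nat \<Rightarrow> 'a \<Rightarrow> real"
  where "\<And>i. i < n \<Longrightarrow> y i \<in> K" and "\<And>i. continuous_on K (c i)"
    and "\<And>i u. u \<in> K \<Longrightarrow> 0 \<le> c i u" and "\<And>u. u \<in> K \<Longrightarrow> (\<Sum>i<n. c i u) = 1"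
    and "\<And>u. u \<in> K \<Longrightarrow> norm ((\<Sum>i<n. c i u *\<^sub>R y i) - u) \<le> e"
proof -
  obtain n :: nat and y where y: "\<And>i. i < n \<Longrightarrow> y i \<in> K"
    and net: "\<And>u. u \<in> K \<Longrightarrow> \<exists>i<n. dist (y i) u < e"
    using compact_finite_net[OF assms] by metis
  define h where "h i u = max 0 (e - dist (y i) u)" for i u
  define c where "c i u = h i u / (\<Sum>j<n. h j u)" for i u
  have sum_pos: "0 < (\<Sum>i<n. h i u)" if "u \<in> K" for u
  proof -
    obtain i where "i < n" "dist (y i) u < e"
      using net[OF \<open>u \<in> K\<close>] by blast
    then show ?thesis by (intro sum_pos2[where i = i]) (auto simp: h_def)
  qed
  have c_nonneg: "0 \<le> c i u" for i u
    by (simp add: c_def h_def sum_nonneg)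
  have c_sum: "(\<Sum>i<n. c i u) = 1" if "u \<in> K" for u
    using sum_pos[OF that] by (simp add: c_def flip: sum_divide_distrib)
  show thesis
  proof (rule that)
    show "continuous_on K (c i)" for i
      unfolding c_def h_def using sum_pos by (intro continuous_intros) (force simp: h_def)
    show "norm ((\<Sum>i<n. c i u *\<^sub>R y i) - u) \<le> e" if "u \<in> K" for u
      using c_nonneg c_sum[OF that]
      by (rule norm_convex_combination_diff_le) (auto simp: c_def h_def dist_norm)
  qed (simp_all add: y c_nonneg c_sum)
qed

text \<open>The normalisation makes the weights add up to at most 1 on the whole cube; a missing mass is put
  on p.\<close>

definition cube_combination :: "nat \<Rightarrow> 'a \<Rightarrow> (nat \<Rightarrow> 'a) \<Rightarrow> (nat \<Rightarrow> real) \<Rightarrow> 'a::real_normed_vector" where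
  "cube_combination n p y a = p + (\<Sum>i<n. (a i / max 1 (\<Sum>j<n. a j)) *\<^sub>R (y i - p))"

lemma cube_combination_in_convex:
  assumes S: "convex S" and p: "p \<in> S" and y: "\<And>i. i < n \<Longrightarrow> y i \<in> S" and a: "a \<in> hilbert_cube"
  shows "cube_combination n p y a \<in> S"
proof -
  define b where "b i = a i / max 1 (\<Sum>j<n. a j)" for i
  have b: "0 \<le> b i" "(\<Sum>i<n. b i) \<le> 1" for i
    using hilbert_cubeD[OF a]
    by (auto simp: b_def le_max_iff_disj divide_le_eq_1 less_max_iff_disj simp flip: sum_divide_distrib)
  have "(\<Sum>i<Suc n. (if i < n then b i else 1 - (\<Sum>i<n. b i)) *\<^sub>R (if i < n then y i else p)) \<in> S"
    using S p y b by (intro convex_sum) auto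
  moreover have "cube_combination n p y a = (\<Sum>i<n. b i *\<^sub>R y i) + (1 - (\<Sum>i<n. b i)) *\<^sub>R p"
    by (simp add: cube_combination_def scaleR_right_diff_distrib sum_subtractf
        scaleR_left_diff_distrib scaleR_left.sum flip: b_def)
  ultimately show ?thesis by simp
qed

lemma continuous_on_cube_combination: "continuous_on A (cube_combination n p y)"
  unfolding cube_combination_def
  by (intro continuous_intros continuous_on_subset[OF continuous_on_product_coordinates]) auto

lemma cube_combination_eq_sum:
  assumes "(\<Sum>i<n. a i) = 1" shows "cube_combination n p y a = (\<Sum>i<n. a i *\<^sub>R y i)"
  using assms
  by (simp add: cube_combination_def scaleR_right_diff_distrib sum_subtractf flip: scaleR_left.sum)

lemma schauder_approximate_fixed_point:
  fixes S K :: "'a::real_normed_vector set"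
  assumes S: "convex S" "S \<noteq> {}" and K: "compact K" "K \<subseteq> S"
    and F: "F \<in> S \<rightarrow> K" and cont: "continuous_on S F" and e: "0 < e"
  obtains x where "x \<in> S" "norm (x - F x) \<le> e"
proof -
  obtain p where p: "p \<in> S" using S(2) by blast
  obtain n :: nat and y c where y: "\<And>i. i < n \<Longrightarrow> y i \<in> K" and c_cont: "\<And>i. continuous_on K (c i)"
    and c_nonneg: "\<And>i u. u \<in> K \<Longrightarrow> 0 \<le> c i u" and c_sum: "\<And>u. u \<in> K \<Longrightarrow> (\<Sum>i<n. c i u) = 1"
    and near: "\<And>u. u \<in> K \<Longrightarrow> norm ((\<Sum>i<n. c i u *\<^sub>R y i) - u) \<le> e"
    by (rule schauder_projection[OF K(1) e]) (rule that)
  define P where "P = cube_combination n p y"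
  define G where "G a i = (if i < n then c i (F (P a)) else 0)" for a i
  have P: "P a \<in> S" if "a \<in> hilbert_cube" for a
    unfolding P_def using y K(2) by (intro cube_combination_in_convex[OF S(1) p _ that]) blast
  have "c i u \<le> 1" if "u \<in> K" "i < n" for i u
    using member_le_sum[of i "{..<n}" "\<lambda>i. c i u"] c_nonneg c_sum that by simp
  then have "G \<in> hilbert_cube \<rightarrow> hilbert_cube"
    using funcset_mem[OF F P] c_nonneg by (auto simp: G_def hilbert_cube_def)
  moreover have "continuous_on hilbert_cube G"
  proof (rule continuous_on_coordinatewise_then_product)
    have "continuous_on hilbert_cube P"
      unfolding P_def by (rule continuous_on_cube_combination)
    then have "continuous_on hilbert_cube (\<lambda>a. c i (F (P a)))" for i
      using P F by (intro continuous_on_compose2[OF c_cont] continuous_on_compose2[OF cont]) auto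
    then show "continuous_on hilbert_cube (\<lambda>a. G a i)" for i
      by (cases "i < n") (simp_all add: G_def)
  qed
  ultimately obtain a where a: "a \<in> hilbert_cube" "G a = a"
    by (rule hilbert_cube_fixed_point)
  define u where "u = F (P a)"
  have u: "u \<in> K" using F P[OF a(1)] by (auto simp: u_def)
  have a_eq: "a i = c i u" if "i < n" for i
    using fun_cong[OF a(2), of i] that by (simp add: G_def u_def)
  then have "P a = (\<Sum>i<n. c i u *\<^sub>R y i)"
    using c_sum[OF u] by (simp add: P_def cube_combination_eq_sum)
  then show thesis
    using that[OF P[OF a(1)]] near[OF u] by (simp add: u_def)
qed

theorem schauder_fixed_point:
  fixes S K :: "'a::real_normed_vector set"
  assumes S: "convex S" "S \<noteq> {}" and K: "compact K" "K \<subseteq> S"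
    and F: "F \<in> S \<rightarrow> K" and cont: "continuous_on S F"
  obtains x where "x \<in> S" "F x = x"
proof -
  have "\<exists>x\<in>S. norm (x - F x) \<le> 1 / Suc n" for n
    by (rule schauder_approximate_fixed_point[OF assms, of "1 / Suc n"]) auto
  then obtain x where x: "x n \<in> S" and approx: "norm (x n - F (x n)) \<le> 1 / Suc n" for n
    by metis
  obtain z r where z: "z \<in> K" and r: "strict_mono r" and lim: "(\<lambda>n. F (x (r n))) \<longlonglongrightarrow> z"
    using seq_compactE[OF compact_imp_seq_compact[OF K(1)], of "\<lambda>n. F (x n)"] funcset_mem[OF F x]
    by (auto simp: o_def)
  have "(\<lambda>n. x (r n) - F (x (r n))) \<longlonglongrightarrow> 0"
    using approx by (intro Lim_null_comparison[OF _ LIMSEQ_inverse_Suc_subseq[OF r]]) simp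
  from tendsto_add[OF this lim] have "(\<lambda>n. x (r n)) \<longlonglongrightarrow> z" by simp
  then have "(\<lambda>n. F (x (r n))) \<longlonglongrightarrow> F z"
    by (rule continuous_on_tendsto_compose[OF cont]) (use z K(2) x in auto)
  then have "F z = z" using lim by (rule LIMSEQ_unique)
  with that z K(2) show thesis by blast
qed

section \<open>Equicontinuous families\<close>

lemma compact_closure_sequentially:
  fixes S :: "'a::metric_space set"
  assumes subseq: "\<And>X :: nat \<Rightarrow> 'a. range X \<subseteq> S \<Longrightarrow> \<exists>l r. strict_mono r \<and> (X \<circ> r) \<longlonglongrightarrow> l"
  shows "compact (closure S)"
  unfolding compact_eq_seq_compact_metric
proof (rule seq_compactI)
  fix Y :: "nat \<Rightarrow> 'a" assume "\<forall>n. Y n \<in> closure S"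
  then have "\<exists>x\<in>S. dist x (Y n) < 1 / Suc n" for n
    by (simp add: closure_approachable)
  then obtain X where X: "\<And>n. X n \<in> S" "\<And>n. dist (X n) (Y n) < 1 / Suc n"
    by metis
  then obtain l r where r: "strict_mono r" and lim: "(X \<circ> r) \<longlonglongrightarrow> l"
    using subseq[of X] by blast
  have bound: "(\<lambda>n. 1 / Suc (r n) + dist ((X \<circ> r) n) l) \<longlonglongrightarrow> 0"
    using LIMSEQ_inverse_Suc_subseq[OF r] lim unfolding tendsto_dist_iff[of "X \<circ> r"]
    by (rule tendsto_add_zero)
  have "dist ((Y \<circ> r) n) l \<le> 1 / Suc (r n) + dist ((X \<circ> r) n) l" for n
    using dist_triangle3[of "Y (r n)" l "X (r n)"] X(2)[of "r n"] by simp
  then have "(Y \<circ> r) \<longlonglongrightarrow> l"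
    unfolding tendsto_dist_iff[of "Y \<circ> r"] by (intro Lim_null_comparison[OF _ bound]) simp
  moreover have "l \<in> closure S"
    unfolding closure_sequential using X(1) lim by (intro exI[of _ "X \<circ> r"]) simp
  ultimately show "\<exists>l\<in>closure S. \<exists>r. strict_mono r \<and> (Y \<circ> r) \<longlonglongrightarrow> l"
    using r by blast
qed

definition equicontinuous_on :: "'a::metric_space set \<Rightarrow> ('a \<Rightarrow> 'b::metric_space) set \<Rightarrow> bool" where
  "equicontinuous_on S E \<longleftrightarrow>
    (\<forall>x\<in>S. \<forall>e>0. \<exists>d>0. \<forall>f\<in>E. \<forall>y\<in>S. dist y x < d \<longrightarrow> dist (f y) (f x) < e)"

lemma equicontinuous_on_imp_continuous_on:
  assumes "equicontinuous_on S E" "f \<in> E" shows "continuous_on S f"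
  unfolding continuous_on_iff
proof (intro ballI allI impI)
  fix x e assume "x \<in> S" "0 < (e :: real)"
  then obtain d where "0 < d" "\<forall>f\<in>E. \<forall>y\<in>S. dist y x < d \<longrightarrow> dist (f y) (f x) < e"
    using assms(1) unfolding equicontinuous_on_def by blast
  with assms(2) show "\<exists>d>0. \<forall>y\<in>S. dist y x < d \<longrightarrow> dist (f y) (f x) < e"
    by blast
qed

definition ext_bcontfun :: "('a::euclidean_space \<Rightarrow> 'b::metric_space) \<Rightarrow> 'a \<Rightarrow> 'a \<Rightarrow> 'a \<Rightarrow>\<^sub>C 'b" where
  "ext_bcontfun f a b = Bcontfun (ext_cont f a b)"

lemma ext_bcontfun_apply:
  assumes "continuous_on (cbox a b) f"
  shows "apply_bcontfun (ext_bcontfun f a b) x = f (clamp a b x)"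
proof -
  obtain g :: "'a \<Rightarrow>\<^sub>C 'b" where "\<And>x. g x = f (clamp a b x)"
    by (rule continuous_on_cbox_bcontfunE[OF assms]) (rule that)
  then have g: "ext_cont f a b = apply_bcontfun g"
    by (auto simp: ext_cont_def)
  have "apply_bcontfun (ext_bcontfun f a b) = ext_cont f a b"
    by (simp only: ext_bcontfun_def g apply_bcontfun_inverse)
  then show ?thesis
    by (simp add: ext_cont_def)
qed

lemma dist_ext_bcontfun_le:
  assumes "cbox a b \<noteq> {}" and cont: "continuous_on (cbox a b) f" "continuous_on (cbox a b) g"
    and le: "\<And>x. x \<in> cbox a b \<Longrightarrow> dist (f x) (g x) \<le> d"
  shows "dist (ext_bcontfun f a b) (ext_bcontfun g a b) \<le> d"
proof (rule dist_bound)
  fix x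
  have "clamp a b x \<in> cbox a b"
    using assms(1) by (simp add: box_ne_empty)
  then show "dist (ext_bcontfun f a b x) (ext_bcontfun g a b x) \<le> d"
    by (simp add: ext_bcontfun_apply cont le)
qed

lemma compact_closure_ext_bcontfun:
  fixes E :: "('a::euclidean_space \<Rightarrow> 'b::{real_normed_vector, heine_borel}) set"
  assumes ne: "cbox a b \<noteq> {}" and equicont: "equicontinuous_on (cbox a b) E"
    and bounded: "\<And>f x. f \<in> E \<Longrightarrow> x \<in> cbox a b \<Longrightarrow> norm (f x) \<le> B"
  shows "compact (closure ((\<lambda>f. ext_bcontfun f a b) ` E))"
proof (rule compact_closure_sequentially)
  fix X :: "nat \<Rightarrow> 'a \<Rightarrow>\<^sub>C 'b" assume "range X \<subseteq> (\<lambda>f. ext_bcontfun f a b) ` E"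
  then have "\<forall>n. \<exists>h\<in>E. X n = ext_bcontfun h a b"
    by auto
  then obtain f where f: "\<And>n. f n \<in> E" and X: "\<And>n. X n = ext_bcontfun (f n) a b"
    by metis
  obtain g r where g: "continuous_on (cbox a b) g" and r: "strict_mono (r :: nat \<Rightarrow> nat)"
    and unif: "\<And>e. 0 < e \<Longrightarrow> \<exists>N. \<forall>n x. n \<ge> N \<and> x \<in> cbox a b \<longrightarrow> norm (f (r n) x - g x) < e"
  proof (rule Arzela_Ascoli[of "cbox a b" f B])
    fix x e assume "x \<in> cbox a b" "0 < (e :: real)"
    then obtain d where "0 < d" "\<forall>f\<in>E. \<forall>y\<in>cbox a b. dist y x < d \<longrightarrow> dist (f y) (f x) < e"
      using equicont unfolding equicontinuous_on_def by blast
    then show "\<exists>d>0. \<forall>n y. y \<in> cbox a b \<and> norm (x - y) < d \<longrightarrow> norm (f n x - f n y) < e"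
      using f by (intro exI[of _ d]) (simp add: dist_norm norm_minus_commute)
  qed (use bounded f in auto)
  have "(X \<circ> r) \<longlonglongrightarrow> ext_bcontfun g a b"
  proof (rule metric_LIMSEQ_I)
    fix e :: real assume "0 < e"
    then obtain N where N: "\<And>n x. n \<ge> N \<Longrightarrow> x \<in> cbox a b \<Longrightarrow> norm (f (r n) x - g x) < e / 2"
      using unif[of "e / 2"] by auto
    have "dist ((X \<circ> r) n) (ext_bcontfun g a b) \<le> e / 2" if "n \<ge> N" for n
      using N[OF that] unfolding X comp_apply
      by (intro dist_ext_bcontfun_le ne equicontinuous_on_imp_continuous_on[OF equicont] f g)
        (simp add: dist_norm less_imp_le)
    then show "\<exists>N. \<forall>n\<ge>N. dist ((X \<circ> r) n) (ext_bcontfun g a b) < e"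
      using \<open>0 < e\<close> by (intro exI[of _ N]) fastforce
  qed
  with r show "\<exists>l r. strict_mono r \<and> (X \<circ> r) \<longlonglongrightarrow> l" by blast
qed

section \<open>Functions of bounded variation and their dual\<close>

lemma partition_sum_Nil [simp]: "partition_sum f [] = 0"
  by (simp add: partition_sum_def)

lemma Nil_in_partitions [simp]: "[] \<in> partitions a b"
  by (simp add: partitions_def)

lemma partition_sum_le_total_variation:
  "bounded_variation f a b \<Longrightarrow> xs \<in> partitions a b \<Longrightarrow> partition_sum f xs \<le> total_variation f a b"
  unfolding total_variation_def bounded_variation_def
  by (elim exE, rule cSUP_upper) (auto intro: bdd_aboveI2)

lemma total_variation_leI:
  "(\<And>xs. xs \<in> partitions a b \<Longrightarrow> partition_sum f xs \<le> B) \<Longrightarrow> total_variation f a b \<le> B"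
  unfolding total_variation_def using Nil_in_partitions[of a b] by (blast intro: cSUP_least)

lemma total_variation_nonneg: "bounded_variation f a b \<Longrightarrow> 0 \<le> total_variation f a b"
  using partition_sum_le_total_variation[of f a b "[]"] by simp

lemma partition_sum_add:
  "partition_sum (\<lambda>t. f t + g t) xs \<le> partition_sum f xs + partition_sum g xs"
  unfolding partition_sum_def sum.distrib[symmetric] by (intro sum_mono) linarith

lemma partition_sum_cmult: "partition_sum (\<lambda>t. c * f t) xs = \<bar>c\<bar> * partition_sum f xs"
  by (simp add: partition_sum_def sum_distrib_left abs_mult flip: right_diff_distrib)

lemma bounded_variation_add:
  assumes "bounded_variation f a b" "bounded_variation g a b"
  shows "bounded_variation (\<lambda>t. f t + g t) a b"
proof -
  obtain A B where "\<forall>xs\<in>partitions a b. partition_sum f xs \<le> A"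
      "\<forall>xs\<in>partitions a b. partition_sum g xs \<le> B"
    using assms unfolding bounded_variation_def by blast
  then have "\<forall>xs\<in>partitions a b. partition_sum (\<lambda>t. f t + g t) xs \<le> A + B"
    by (blast intro: add_mono order_trans[OF partition_sum_add])
  then show ?thesis unfolding bounded_variation_def by blast
qed

lemma bounded_variation_cmult:
  assumes "bounded_variation f a b" shows "bounded_variation (\<lambda>t. c * f t) a b"
  using assms unfolding bounded_variation_def partition_sum_cmult
  by (meson abs_ge_zero mult_left_mono)

lemma total_variation_add:
  assumes "bounded_variation f a b" "bounded_variation g a b"
  shows "total_variation (\<lambda>t. f t + g t) a b \<le> total_variation f a b + total_variation g a b"
  using assms by (intro total_variation_leI order_trans[OF partition_sum_add] add_mono
      partition_sum_le_total_variation)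

lemma total_variation_cmult_le:
  assumes "bounded_variation f a b"
  shows "total_variation (\<lambda>t. c * f t) a b \<le> \<bar>c\<bar> * total_variation f a b"
  using assms
  by (intro total_variation_leI)
     (simp add: partition_sum_cmult mult_left_mono partition_sum_le_total_variation)

lemma CBV_bounded_variation: "x \<in> CBV \<Longrightarrow> bounded_variation x 0 1"
  by (simp add: CBV_def)

lemma CBV_add: "x \<in> CBV \<Longrightarrow> y \<in> CBV \<Longrightarrow> (\<lambda>t. x t + y t) \<in> CBV"
  by (auto simp: CBV_def intro: continuous_on_add bounded_variation_add)

lemma CBV_cmult: "x \<in> CBV \<Longrightarrow> (\<lambda>t. c * x t) \<in> CBV"
  by (auto simp: CBV_def intro: continuous_on_mult_left bounded_variation_cmult)

lemma CBV_diff: "x \<in> CBV \<Longrightarrow> y \<in> CBV \<Longrightarrow> (\<lambda>t. x t - y t) \<in> CBV"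
  using CBV_add[OF _ CBV_cmult[of y "-1"]] by simp

lemma partition_sum_constant:
  assumes xs: "xs \<in> partitions a b" and f: "\<And>t. t \<in> {a..b} \<Longrightarrow> f t = c"
  shows "partition_sum f xs = 0"
proof -
  have "f (xs ! i) = c" if "i < length xs" for i
    using xs nth_mem[OF that] by (intro f) (auto simp: partitions_def)
  then show ?thesis by (simp add: partition_sum_def)
qed

lemma indicator_in_CBV: "indicator {0..1} \<in> CBV"
proof -
  have "continuous_on {0..1::real} (indicator {0..1} :: real \<Rightarrow> real)"
    by (rule continuous_on_eq[OF continuous_on_const[of _ 1]]) simp
  moreover have "bounded_variation (indicator {0..1}) 0 1"
    unfolding bounded_variation_def
    using partition_sum_constant[of _ 0 1 "indicator {0..1}" 1] by (intro exI[of _ 0]) simp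
  ultimately show ?thesis by (simp add: CBV_def)
qed

lemma BV_norm_indicator: "BV_norm (indicator {0..1}) = 1"
proof -
  have "total_variation (indicator {0..1}) 0 1 \<le> 0"
    using partition_sum_constant[of _ 0 1 "indicator {0..1}" 1] by (intro total_variation_leI) simp
  with total_variation_nonneg[OF CBV_bounded_variation[OF indicator_in_CBV]] show ?thesis
    by (simp add: BV_norm_def)
qed

lemma BV_norm_nonneg: "x \<in> CBV \<Longrightarrow> 0 \<le> BV_norm x"
  by (simp add: BV_norm_def CBV_bounded_variation total_variation_nonneg)

lemma BV_norm_add: "x \<in> CBV \<Longrightarrow> y \<in> CBV \<Longrightarrow> BV_norm (\<lambda>t. x t + y t) \<le> BV_norm x + BV_norm y"
  using total_variation_add[of x 0 1 y] by (simp add: BV_norm_def CBV_bounded_variation)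

lemma BV_norm_cmult_le: "x \<in> CBV \<Longrightarrow> BV_norm (\<lambda>t. c * x t) \<le> \<bar>c\<bar> * BV_norm x"
  using total_variation_cmult_le[of x 0 1 c]
  by (simp add: BV_norm_def CBV_bounded_variation abs_mult distrib_left)

lemma abs_le_BV_norm:
  assumes "x \<in> CBV" shows "\<bar>x t\<bar> \<le> BV_norm x"
proof (cases "t \<in> {0..1}")
  case True
  then have "[0, t] \<in> partitions 0 1" by (simp add: partitions_def)
  from partition_sum_le_total_variation[OF CBV_bounded_variation[OF assms] this]
  have "\<bar>x t - x 0\<bar> \<le> total_variation x 0 1" by (simp add: partition_sum_def)
  then show ?thesis by (simp add: BV_norm_def)
next
  case False
  then show ?thesis using assms BV_norm_nonneg[OF assms] by (simp add: CBV_def)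
qed

lemma CBV_dual_add: "\<alpha> \<in> CBV_dual \<Longrightarrow> x \<in> CBV \<Longrightarrow> y \<in> CBV \<Longrightarrow> \<alpha> (\<lambda>t. x t + y t) = \<alpha> x + \<alpha> y"
  by (simp add: CBV_dual_def)

lemma CBV_dual_cmult: "\<alpha> \<in> CBV_dual \<Longrightarrow> x \<in> CBV \<Longrightarrow> \<alpha> (\<lambda>t. c * x t) = c * \<alpha> x"
  by (simp add: CBV_dual_def)

lemma CBV_dual_diff:
  assumes "\<alpha> \<in> CBV_dual" "x \<in> CBV" "y \<in> CBV" shows "\<alpha> (\<lambda>t. x t - y t) = \<alpha> x - \<alpha> y"
  using CBV_dual_add[OF assms(1,2) CBV_cmult[OF assms(3), of "-1"]]
    CBV_dual_cmult[OF assms(1,3), of "-1"] by simp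

lemma diff_in_CBV_dual:
  assumes "\<alpha> \<in> CBV_dual" "\<beta> \<in> CBV_dual" shows "(\<lambda>x. \<alpha> x - \<beta> x) \<in> CBV_dual"
proof -
  obtain C D where "\<forall>x\<in>CBV. \<bar>\<alpha> x\<bar> \<le> C * BV_norm x" "\<forall>x\<in>CBV. \<bar>\<beta> x\<bar> \<le> D * BV_norm x"
    using assms unfolding CBV_dual_def by auto
  then have "\<forall>x\<in>CBV. \<bar>\<alpha> x - \<beta> x\<bar> \<le> (C + D) * BV_norm x"
    unfolding distrib_right by (meson abs_triangle_ineq4 add_mono order_trans)
  then show ?thesis
    using assms unfolding CBV_dual_def by (auto simp: right_diff_distrib)
qed

lemma dual_norm_bound:
  assumes \<alpha>: "\<alpha> \<in> CBV_dual" and x: "x \<in> CBV"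
  shows "\<bar>\<alpha> x\<bar> \<le> dual_norm \<alpha> * BV_norm x"
proof -
  obtain C where C: "\<And>x. x \<in> CBV \<Longrightarrow> \<bar>\<alpha> x\<bar> \<le> C * BV_norm x"
    using \<alpha> unfolding CBV_dual_def by blast
  show ?thesis
  proof (cases "BV_norm x = 0")
    case True
    then show ?thesis using C[OF x] by simp
  next
    case False
    then have pos: "0 < BV_norm x" using BV_norm_nonneg[OF x] by simp
    define y where "y = (\<lambda>t. inverse (BV_norm x) * x t)"
    have y: "y \<in> CBV" "BV_norm y \<le> 1"
      unfolding y_def using CBV_cmult[OF x] BV_norm_cmult_le[OF x, of "inverse (BV_norm x)"] pos
      by auto
    have "\<bar>\<alpha> z\<bar> \<le> \<bar>C\<bar>" if z: "z \<in> CBV" "BV_norm z \<le> 1" for z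
    proof -
      have "C * BV_norm z \<le> \<bar>C\<bar> * 1"
        using z BV_norm_nonneg[OF z(1)] by (intro mult_mono) auto
      then show ?thesis using C[OF z(1)] by simp
    qed
    then have "\<bar>\<alpha> y\<bar> \<le> dual_norm \<alpha>"
      unfolding dual_norm_def using y by (intro cSUP_upper bdd_aboveI2[where M = "\<bar>C\<bar>"]) auto
    moreover have "\<alpha> x = BV_norm x * \<alpha> y"
      using CBV_dual_cmult[OF \<alpha> x, of "inverse (BV_norm x)"] pos by (simp add: y_def)
    ultimately show ?thesis
      using pos by (simp add: abs_mult mult.commute)
  qed
qed

lemma dual_norm_nonneg: "\<alpha> \<in> CBV_dual \<Longrightarrow> 0 \<le> dual_norm \<alpha>"
  using dual_norm_bound[OF _ indicator_in_CBV, of \<alpha>] abs_ge_zero[of "\<alpha> (indicator {0..1})"]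
  by (simp add: BV_norm_indicator)

lemma dual_norm_minus_commute: "dual_norm (\<lambda>x. \<beta> x - \<alpha> x) = dual_norm (\<lambda>x. \<alpha> x - \<beta> x)"
  by (simp add: dual_norm_def abs_minus_commute)

lemma CBV_dual_tendsto:
  assumes "\<alpha> \<in> CBV_dual" "\<And>n. X n \<in> CBV" "x \<in> CBV"
    and lim: "(\<lambda>n. BV_norm (\<lambda>t. X n t - x t)) \<longlonglongrightarrow> 0"
  shows "(\<lambda>n. \<alpha> (X n)) \<longlonglongrightarrow> \<alpha> x"
proof (rule LIM_zero_cancel, rule Lim_null_comparison)
  show "\<forall>\<^sub>F n in sequentially. norm (\<alpha> (X n) - \<alpha> x) \<le> dual_norm \<alpha> * BV_norm (\<lambda>t. X n t - x t)"
    using dual_norm_bound[OF assms(1) CBV_diff[OF assms(2,3)]] CBV_dual_diff[OF assms(1-3)] by simp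
  show "(\<lambda>n. dual_norm \<alpha> * BV_norm (\<lambda>t. X n t - x t)) \<longlonglongrightarrow> 0"
    using tendsto_mult_right_zero[OF lim] .
qed

section \<open>Measurability and integrability\<close>

lemma complete_measure_restrict_space:
  assumes M: "complete_measure M" and S: "S \<in> sets M"
  shows "complete_measure (restrict_space M S)"
proof
  fix A B assume "B \<subseteq> A" "A \<in> null_sets (restrict_space M S)"
  then have "B \<in> sets M" "B \<subseteq> S"
    using complete_measure.complete[OF M] null_sets_restrict_space[OF S] by auto
  then show "B \<in> sets (restrict_space M S)"
    using S by (simp add: sets_restrict_space_iff)
qed

lemma complete_measure_lebesgue_on: "S \<in> sets lebesgue \<Longrightarrow> complete_measure (lebesgue_on S)"
  by (rule complete_measure_restrict_space[OF completion.complete_measure_axioms])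

lemma (in complete_measure) measurable_AE_cong:
  assumes f: "f \<in> measurable M N" and eq: "AE x in M. f x = g x" and g: "g \<in> space M \<rightarrow> space N"
  shows "g \<in> measurable M N"
proof (rule measurableI)
  show "g x \<in> space N" if "x \<in> space M" for x
    using g that by blast
  fix A assume A: "A \<in> sets N"
  show "g -` A \<inter> space M \<in> sets M"
  proof (rule in_sets_AE)
    show "AE x in M. x \<in> f -` A \<inter> space M \<longleftrightarrow> x \<in> g -` A \<inter> space M"
      using eq by eventually_elim auto
  qed (use f A in \<open>auto intro: measurable_sets\<close>)
qed

lemma (in complete_measure) borel_measurable_LIMSEQ_AE:
  fixes f :: "nat \<Rightarrow> 'a \<Rightarrow> 'b::{banach, second_countable_topology}"
  assumes f: "\<And>n. f n \<in> borel_measurable M" and lim: "AE x in M. (\<lambda>n. f n x) \<longlonglongrightarrow> g x"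
  shows "g \<in> borel_measurable M"
proof (rule measurable_AE_cong)
  show "(\<lambda>x. lim (\<lambda>n. f n x)) \<in> borel_measurable M"
    using f by (rule borel_measurable_lim_metric)
  show "AE x in M. lim (\<lambda>n. f n x) = g x"
    using lim by eventually_elim (rule limI)
qed simp

text \<open>Completeness of the measure is needed because continuity in the second variable may fail on a
  null set.\<close>

lemma (in complete_measure) borel_measurable_superposition:
  fixes f :: "'a \<Rightarrow> 'b::{metric_space, second_countable_topology} \<Rightarrow> 'c::{banach, second_countable_topology}"
  assumes f: "\<And>u. (\<lambda>s. f s u) \<in> borel_measurable M"
    and cont: "AE s in M. continuous_on UNIV (f s)" and x: "x \<in> borel_measurable M"
  shows "(\<lambda>s. f s (x s)) \<in> borel_measurable M"
proof -
  obtain X where X: "\<And>n. simple_function M (X n)" and lim: "\<And>s. s \<in> space M \<Longrightarrow> (\<lambda>n. X n s) \<longlonglongrightarrow> x s"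
    using borel_measurable_implies_sequence_metric[OF x] by metis
  show ?thesis
  proof (rule borel_measurable_LIMSEQ_AE)
    show "(\<lambda>s. f s (X n s)) \<in> borel_measurable M" for n
    proof (rule measurable_compose_countable'[where f = "\<lambda>u s. f s u" and g = "X n"])
      show "X n \<in> measurable M (count_space (X n ` space M))"
        using X[of n] by (auto simp: simple_function_def measurable_count_space_eq2)
      show "countable (X n ` space M)"
        using X[of n] by (simp add: simple_function_def countable_finite)
    qed (rule f)
    show "AE s in M. (\<lambda>n. f s (X n s)) \<longlonglongrightarrow> f s (x s)"
      using cont AE_space
      by eventually_elim (auto intro: continuous_on_tendsto_compose lim)
  qed
qed

lemma integrable_mult_essentially_bounded:
  fixes g h :: "'a \<Rightarrow> real"
  assumes g: "integrable M g" and h: "h \<in> borel_measurable M" "AE x in M. \<bar>h x\<bar> \<le> C"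
  shows "integrable M (\<lambda>x. g x * h x)"
proof (rule Bochner_Integration.integrable_bound)
  show "integrable M (\<lambda>x. C * \<bar>g x\<bar>)"
    using g by simp
  show "AE x in M. norm (g x * h x) \<le> norm (C * \<bar>g x\<bar>)"
    using h(2)
  proof eventually_elim
    fix x assume "\<bar>h x\<bar> \<le> C"
    then have "\<bar>g x\<bar> * \<bar>h x\<bar> \<le> \<bar>g x\<bar> * \<bar>C\<bar>"
      by (intro mult_left_mono) auto
    then show "norm (g x * h x) \<le> norm (C * \<bar>g x\<bar>)"
      by (simp add: abs_mult mult.commute)
  qed
qed (use g h in measurable)

lemma integrable_mult_conjugate_powr:
  fixes g h :: "'a \<Rightarrow> real"
  assumes pq: "1 < p" "1 < q" "1 / p + 1 / q = 1"
    and g: "g \<in> borel_measurable M" "integrable M (\<lambda>x. \<bar>g x\<bar> powr q)"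
    and h: "h \<in> borel_measurable M" "integrable M (\<lambda>x. \<bar>h x\<bar> powr p)"
  shows "integrable M (\<lambda>x. g x * h x)"
proof (rule Bochner_Integration.integrable_bound)
  show "integrable M (\<lambda>x. \<bar>h x\<bar> powr p / p + \<bar>g x\<bar> powr q / q)"
    using g h by simp
  show "AE x in M. norm (g x * h x) \<le> norm (\<bar>h x\<bar> powr p / p + \<bar>g x\<bar> powr q / q)"
  proof (rule AE_I2)
    fix x
    have "\<bar>h x\<bar> * \<bar>g x\<bar> \<le> \<bar>h x\<bar> powr p / p + \<bar>g x\<bar> powr q / q"
      using Youngs_inequality[OF pq] by simp
    then show "norm (g x * h x) \<le> norm (\<bar>h x\<bar> powr p / p + \<bar>g x\<bar> powr q / q)"
      by (simp add: abs_mult mult.commute)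
  qed
qed (use g h in measurable)

lemma memLp_mult_integrable:
  fixes p :: ereal and q :: real
  assumes p: "1 < p" and q: "1 \<le> q" and pq: "inverse p + ereal (1 / q) = 1"
    and h: "memLp p h" and g: "memLp (ereal q) g"
  shows "integrable (lebesgue_on {0..1}) (\<lambda>s. g s * h s)"
proof (cases p)
  case PInf
  then have "q = 1" using pq q by (simp add: one_ereal_def)
  then have "integrable (lebesgue_on {0..1}) g"
    using g integrable_abs_iff by (auto simp: memLp_def)
  moreover obtain C where "AE t in lebesgue_on {0..1}. \<bar>h t\<bar> \<le> C"
    using h PInf by (auto simp: memLp_def)
  ultimately show ?thesis
    using h by (intro integrable_mult_essentially_bounded) (simp_all add: memLp_def)
next
  case (real r)
  then have "1 < r" using p by simp
  have conj: "1 / r + 1 / q = 1"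
    using pq real \<open>1 < r\<close> by (simp add: one_ereal_def inverse_eq_divide)
  then have "q \<noteq> 1" using \<open>1 < r\<close> by auto
  with q have "1 < q" by simp
  show ?thesis
    using g h real
    by (intro integrable_mult_conjugate_powr[OF \<open>1 < r\<close> \<open>1 < q\<close> conj]) (simp_all add: memLp_def)
next
  case MInf
  then show ?thesis using p by simp
qed

section \<open>Integral operators with kernels of bounded variation\<close>

locale bv_kernel =
  fixes M :: "'a measure" and k :: "real \<Rightarrow> 'a \<Rightarrow> real" and \<phi> m :: "'a \<Rightarrow> real"
  assumes phi_nonneg: "\<And>s. s \<in> space M \<Longrightarrow> 0 \<le> \<phi> s"
    and k_measurable: "\<And>t. t \<in> {0..1} \<Longrightarrow> k t \<in> borel_measurable M"
    and m_measurable: "m \<in> borel_measurable M"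
    and m_nonneg: "\<And>s. s \<in> space M \<Longrightarrow> 0 \<le> m s"
    and k_phi_integrable: "\<And>t. t \<in> {0..1} \<Longrightarrow> integrable M (\<lambda>s. k t s * \<phi> s)"
    and m_phi_integrable: "integrable M (\<lambda>s. m s * \<phi> s)"
    and k_variation: "AE s in M.
           bounded_variation (\<lambda>t. k t s) 0 1 \<and> total_variation (\<lambda>t. k t s) 0 1 \<le> m s"
    and k_continuous: "\<And>\<tau>. \<tau> \<in> {0..1} \<Longrightarrow>
           ((\<lambda>t. LINT s|M. \<bar>k t s - k \<tau> s\<bar> * \<phi> s) \<longlongrightarrow> 0) (at \<tau> within {0..1})"
begin

definition dominated :: "real \<Rightarrow> ('a \<Rightarrow> real) \<Rightarrow> bool" where
  "dominated C g \<longleftrightarrow> g \<in> borel_measurable M \<and> (\<forall>s\<in>space M. \<bar>g s\<bar> \<le> C * \<phi> s)"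

definition int_op :: "('a \<Rightarrow> real) \<Rightarrow> real \<Rightarrow> real" where
  "int_op g t = (if t \<in> {0..1} then LINT s|M. k t s * g s else 0)"

definition weight :: "'a \<Rightarrow> real" where
  "weight s = \<bar>k 0 s\<bar> + m s"

definition weight_mass :: real where
  "weight_mass = (LINT s|M. weight s * \<phi> s)"

lemma dominatedD:
  assumes "dominated C g"
  shows "g \<in> borel_measurable M" "s \<in> space M \<Longrightarrow> \<bar>g s\<bar> \<le> C * \<phi> s"
  using assms by (auto simp: dominated_def)

lemma dominated_abs: "dominated C g \<Longrightarrow> dominated C (\<lambda>s. \<bar>g s\<bar>)"
  by (auto simp: dominated_def)

lemma dominated_diff:
  assumes g: "dominated C g" and h: "dominated D h"
  shows "dominated (C + D) (\<lambda>s. g s - h s)"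
proof -
  have "\<bar>g s - h s\<bar> \<le> (C + D) * \<phi> s" if "s \<in> space M" for s
    using dominatedD(2)[OF g that] dominatedD(2)[OF h that] by (simp add: distrib_right)
  then show ?thesis
    using dominatedD(1)[OF g] dominatedD(1)[OF h] by (simp add: dominated_def)
qed

lemma dominated_mult_integrable:
  assumes h: "h \<in> borel_measurable M" "integrable M (\<lambda>s. h s * \<phi> s)" and g: "dominated C g"
  shows "integrable M (\<lambda>s. h s * g s)"
proof (rule Bochner_Integration.integrable_bound)
  show "integrable M (\<lambda>s. C * (h s * \<phi> s))"
    using h(2) by simp
  show "(\<lambda>s. h s * g s) \<in> borel_measurable M"
    using h(1) dominatedD(1)[OF g] by simp
  show "AE s in M. norm (h s * g s) \<le> norm (C * (h s * \<phi> s))"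
  proof (rule AE_I2)
    fix s assume "s \<in> space M"
    then have "\<bar>h s\<bar> * \<bar>g s\<bar> \<le> \<bar>h s\<bar> * \<bar>C * \<phi> s\<bar>"
      using dominatedD(2)[OF g] by (intro mult_left_mono) force+
    then show "norm (h s * g s) \<le> norm (C * (h s * \<phi> s))"
      by (simp add: abs_mult mult_ac)
  qed
qed

lemma dominated_integral_le:
  assumes h: "h \<in> borel_measurable M" "integrable M (\<lambda>s. h s * \<phi> s)" "\<And>s. s \<in> space M \<Longrightarrow> 0 \<le> h s"
    and g: "dominated C g"
  shows "(LINT s|M. h s * \<bar>g s\<bar>) \<le> C * (LINT s|M. h s * \<phi> s)"
proof -
  have "(LINT s|M. h s * \<bar>g s\<bar>) \<le> (LINT s|M. C * (h s * \<phi> s))"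
  proof (rule integral_mono)
    show "integrable M (\<lambda>s. h s * \<bar>g s\<bar>)"
      by (rule dominated_mult_integrable[OF h(1,2) dominated_abs[OF g]])
    fix s assume "s \<in> space M"
    then have "h s * \<bar>g s\<bar> \<le> h s * (C * \<phi> s)"
      using dominatedD(2)[OF g] h(3) by (intro mult_left_mono)
    then show "h s * \<bar>g s\<bar> \<le> C * (h s * \<phi> s)" by (simp add: mult_ac)
  qed (use h(2) in simp)
  then show ?thesis by simp
qed

lemma dominated_kernel_integrable: "t \<in> {0..1} \<Longrightarrow> dominated C g \<Longrightarrow> integrable M (\<lambda>s. k t s * g s)"
  by (rule dominated_mult_integrable[OF k_measurable k_phi_integrable])

lemma kernel_diff_measurable:
  "t \<in> {0..1} \<Longrightarrow> \<tau> \<in> {0..1} \<Longrightarrow> (\<lambda>s. \<bar>k t s - k \<tau> s\<bar>) \<in> borel_measurable M"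
  using k_measurable by simp

lemma abs_mult_phi_integrable:
  assumes "integrable M (\<lambda>s. h s * \<phi> s)" shows "integrable M (\<lambda>s. \<bar>h s\<bar> * \<phi> s)"
proof -
  have "integrable M (\<lambda>s. \<bar>h s * \<phi> s\<bar>)"
    using assms by (rule integrable_abs)
  also have "?this \<longleftrightarrow> ?thesis"
    by (rule Bochner_Integration.integrable_cong) (simp_all add: abs_mult phi_nonneg)
  finally show ?thesis .
qed

lemma kernel_diff_phi_integrable:
  assumes "t \<in> {0..1}" "\<tau> \<in> {0..1}"
  shows "integrable M (\<lambda>s. \<bar>k t s - k \<tau> s\<bar> * \<phi> s)"
  using k_phi_integrable[OF assms(1)] k_phi_integrable[OF assms(2)]
  by (intro abs_mult_phi_integrable) (simp add: left_diff_distrib)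

lemma int_op_increment:
  assumes t: "t \<in> {0..1}" "\<tau> \<in> {0..1}" and g: "dominated C g"
  shows "\<bar>int_op g t - int_op g \<tau>\<bar> \<le> (LINT s|M. \<bar>k t s - k \<tau> s\<bar> * \<bar>g s\<bar>)"
proof -
  have "int_op g t - int_op g \<tau> = (LINT s|M. k t s * g s - k \<tau> s * g s)"
    using t g by (simp add: int_op_def dominated_kernel_integrable)
  also have "\<bar>\<dots>\<bar> \<le> (LINT s|M. \<bar>k t s * g s - k \<tau> s * g s\<bar>)"
    by (rule integral_abs_bound)
  also have "\<dots> = (LINT s|M. \<bar>k t s - k \<tau> s\<bar> * \<bar>g s\<bar>)"
    by (simp add: abs_mult flip: left_diff_distrib)
  finally show ?thesis .
qed

lemma int_op_modulus:
  assumes t: "t \<in> {0..1}" "\<tau> \<in> {0..1}" and g: "dominated C g"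
  shows "\<bar>int_op g t - int_op g \<tau>\<bar> \<le> C * (LINT s|M. \<bar>k t s - k \<tau> s\<bar> * \<phi> s)"
  using int_op_increment[OF assms]
    dominated_integral_le[OF kernel_diff_measurable[OF t] kernel_diff_phi_integrable[OF t] _ g]
  by simp

lemma equicontinuous_on_int_op: "equicontinuous_on {0..1} (int_op ` Collect (dominated C))"
  unfolding equicontinuous_on_def
proof (intro ballI allI impI)
  fix t e :: real assume t: "t \<in> {0..1}" and e: "0 < e"
  have "((\<lambda>s. C * (LINT \<sigma>|M. \<bar>k s \<sigma> - k t \<sigma>\<bar> * \<phi> \<sigma>)) \<longlongrightarrow> 0) (at t within {0..1})"
    by (rule tendsto_mult_right_zero[OF k_continuous[OF t]])
  from order_tendstoD(2)[OF this e]
  obtain d where d: "0 < d" and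
    small: "s \<in> {0..1} \<Longrightarrow> s \<noteq> t \<Longrightarrow> dist s t < d \<Longrightarrow> C * (LINT \<sigma>|M. \<bar>k s \<sigma> - k t \<sigma>\<bar> * \<phi> \<sigma>) < e" for s
    unfolding eventually_at by blast
  have "dist (int_op g s) (int_op g t) < e" if "dominated C g" "s \<in> {0..1}" "dist s t < d" for g s
  proof (cases "s = t")
    case False
    then show ?thesis
      using int_op_modulus[OF that(2) t that(1)] small[OF that(2) False that(3)]
      by (simp add: dist_real_def)
  qed (use e in simp)
  with d show "\<exists>d>0. \<forall>y\<in>int_op ` Collect (dominated C). \<forall>s\<in>{0..1}. dist s t < d \<longrightarrow> dist (y s) (y t) < e"
    by blast
qed

lemma int_op_continuous_on: "dominated C g \<Longrightarrow> continuous_on {0..1} (int_op g)"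
  by (rule equicontinuous_on_imp_continuous_on[OF equicontinuous_on_int_op]) blast

lemma int_op_partition_sum:
  assumes g: "dominated C g" and xs: "xs \<in> partitions 0 1"
  shows "partition_sum (int_op g) xs \<le> (LINT s|M. m s * \<bar>g s\<bar>)"
proof -
  define \<Delta> where "\<Delta> i s = \<bar>k (xs ! Suc i) s - k (xs ! i) s\<bar>" for i s
  have xs01: "xs ! i \<in> {0..1}" if "i < length xs" for i
    using xs nth_mem[OF that] by (auto simp: partitions_def)
  have int: "integrable M (\<lambda>s. \<Delta> i s * \<bar>g s\<bar>)" if "i < length xs - 1" for i
    unfolding \<Delta>_def using that
    by (intro dominated_mult_integrable[OF _ _ dominated_abs[OF g]] kernel_diff_measurable
        kernel_diff_phi_integrable xs01) auto
  have "partition_sum (int_op g) xs \<le> (\<Sum>i<length xs - 1. LINT s|M. \<Delta> i s * \<bar>g s\<bar>)"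
    unfolding partition_sum_def \<Delta>_def by (intro sum_mono int_op_increment[OF _ _ g] xs01) auto
  also have "\<dots> = (LINT s|M. (\<Sum>i<length xs - 1. \<Delta> i s * \<bar>g s\<bar>))"
    using int by (intro Bochner_Integration.integral_sum[symmetric]) auto
  also have "\<dots> \<le> (LINT s|M. m s * \<bar>g s\<bar>)"
  proof (rule integral_mono_AE)
    show "integrable M (\<lambda>s. \<Sum>i<length xs - 1. \<Delta> i s * \<bar>g s\<bar>)"
      using int by (intro Bochner_Integration.integrable_sum) auto
    show "integrable M (\<lambda>s. m s * \<bar>g s\<bar>)"
      by (rule dominated_mult_integrable[OF m_measurable m_phi_integrable dominated_abs[OF g]])
    show "AE s in M. (\<Sum>i<length xs - 1. \<Delta> i s * \<bar>g s\<bar>) \<le> m s * \<bar>g s\<bar>"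
      using k_variation
    proof eventually_elim
      case (elim s)
      then have "partition_sum (\<lambda>t. k t s) xs \<le> m s"
        using partition_sum_le_total_variation xs by force
      from mult_right_mono[OF this abs_ge_zero[of "g s"]] show ?case
        by (simp add: partition_sum_def \<Delta>_def sum_distrib_right)
    qed
  qed
  finally show ?thesis .
qed

lemma int_op_in_CBV:
  assumes g: "dominated C g" shows "int_op g \<in> CBV"
proof -
  have "bounded_variation (int_op g) 0 1"
    unfolding bounded_variation_def using int_op_partition_sum[OF g] by blast
  then show ?thesis
    using int_op_continuous_on[OF g] by (simp add: CBV_def int_op_def)
qed

lemma weight_measurable: "weight \<in> borel_measurable M"
  unfolding weight_def using k_measurable[of 0] m_measurable by simp

lemma weight_nonneg: "s \<in> space M \<Longrightarrow> 0 \<le> weight s"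
  by (simp add: weight_def m_nonneg)

lemma weight_phi_integrable: "integrable M (\<lambda>s. weight s * \<phi> s)"
  using abs_mult_phi_integrable[OF k_phi_integrable[of 0]] m_phi_integrable
  by (simp add: weight_def distrib_right)

lemma weight_mass_nonneg: "0 \<le> weight_mass"
  by (simp add: weight_mass_def weight_nonneg phi_nonneg)

lemma BV_norm_int_op:
  assumes g: "dominated C g"
  shows "BV_norm (int_op g) \<le> (LINT s|M. weight s * \<bar>g s\<bar>)"
proof -
  have "\<bar>int_op g 0\<bar> \<le> (LINT s|M. \<bar>k 0 s\<bar> * \<bar>g s\<bar>)"
    using integral_abs_bound[of M "\<lambda>s. k 0 s * g s"] by (simp add: int_op_def abs_mult)
  moreover have "total_variation (int_op g) 0 1 \<le> (LINT s|M. m s * \<bar>g s\<bar>)"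
    by (rule total_variation_leI[OF int_op_partition_sum[OF g]])
  moreover have "integrable M (\<lambda>s. \<bar>k 0 s\<bar> * \<bar>g s\<bar>)"
    using integrable_abs[OF dominated_kernel_integrable[OF _ g, of 0]] by (simp add: abs_mult)
  moreover have "integrable M (\<lambda>s. m s * \<bar>g s\<bar>)"
    by (rule dominated_mult_integrable[OF m_measurable m_phi_integrable dominated_abs[OF g]])
  ultimately show ?thesis
    by (simp add: BV_norm_def weight_def distrib_right)
qed

lemma BV_norm_int_op_le:
  assumes g: "dominated C g" shows "BV_norm (int_op g) \<le> C * weight_mass"
  using BV_norm_int_op[OF g]
    dominated_integral_le[OF weight_measurable weight_phi_integrable weight_nonneg g]
  unfolding weight_mass_def by (rule order_trans)

lemma abs_int_op_le:
  assumes g: "dominated C g" shows "\<bar>int_op g t\<bar> \<le> C * weight_mass"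
  using abs_le_BV_norm[OF int_op_in_CBV[OF g]] BV_norm_int_op_le[OF g] by (rule order_trans)

lemma int_op_diff:
  assumes "dominated C g" "dominated D h"
  shows "int_op (\<lambda>s. g s - h s) = (\<lambda>t. int_op g t - int_op h t)"
  using dominated_kernel_integrable[OF _ assms(1)] dominated_kernel_integrable[OF _ assms(2)]
  by (auto simp: int_op_def right_diff_distrib)

lemma dominated_weighted_L1_tendsto:
  assumes G: "\<And>n. dominated C (G n)" and g: "dominated D g"
    and lim: "AE s in M. (\<lambda>n. G n s) \<longlonglongrightarrow> g s"
  shows "(\<lambda>n. LINT s|M. weight s * \<bar>G n s - g s\<bar>) \<longlonglongrightarrow> 0"
proof -
  have diff: "dominated (C + D) (\<lambda>s. \<bar>G n s - g s\<bar>)" for n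
    by (rule dominated_abs[OF dominated_diff[OF G g]])
  have "(\<lambda>n. LINT s|M. weight s * \<bar>G n s - g s\<bar>) \<longlonglongrightarrow> (LINT s|M. 0)"
  proof (rule integral_dominated_convergence)
    show "integrable M (\<lambda>s. (C + D) * (weight s * \<phi> s))"
      using weight_phi_integrable by simp
    show "(\<lambda>s. weight s * \<bar>G n s - g s\<bar>) \<in> borel_measurable M" for n
      using weight_measurable dominatedD(1)[OF diff] by simp
    show "AE s in M. (\<lambda>n. weight s * \<bar>G n s - g s\<bar>) \<longlonglongrightarrow> 0"
      using lim by eventually_elim (intro tendsto_mult_right_zero tendsto_rabs_zero LIM_zero)
    show "AE s in M. norm (weight s * \<bar>G n s - g s\<bar>) \<le> (C + D) * (weight s * \<phi> s)" for n
    proof (rule AE_I2)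
      fix s assume s: "s \<in> space M"
      then have "weight s * \<bar>G n s - g s\<bar> \<le> weight s * ((C + D) * \<phi> s)"
        using dominatedD(2)[OF diff, of s n] weight_nonneg by (intro mult_left_mono) auto
      then show "norm (weight s * \<bar>G n s - g s\<bar>) \<le> (C + D) * (weight s * \<phi> s)"
        using weight_nonneg[OF s] by (simp add: abs_mult mult_ac)
    qed
  qed simp
  then show ?thesis by simp
qed

lemma int_op_tendsto:
  assumes G: "\<And>n. dominated C (G n)" and g: "dominated D g"
    and lim: "AE s in M. (\<lambda>n. G n s) \<longlonglongrightarrow> g s"
  shows "(\<lambda>n. BV_norm (\<lambda>t. int_op (G n) t - int_op g t)) \<longlonglongrightarrow> 0"
proof (rule Lim_null_comparison[OF _ dominated_weighted_L1_tendsto[OF assms]])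
  have "BV_norm (\<lambda>t. int_op (G n) t - int_op g t) \<le> (LINT s|M. weight s * \<bar>G n s - g s\<bar>)" for n
    using BV_norm_int_op[OF dominated_diff[OF G g]] unfolding int_op_diff[OF G g] .
  moreover have "0 \<le> BV_norm (\<lambda>t. int_op (G n) t - int_op g t)" for n
    by (intro BV_norm_nonneg CBV_diff int_op_in_CBV[OF G] int_op_in_CBV[OF g])
  ultimately show "\<forall>\<^sub>F n in sequentially. norm (BV_norm (\<lambda>t. int_op (G n) t - int_op g t))
      \<le> (LINT s|M. weight s * \<bar>G n s - g s\<bar>)"
    by simp
qed

end

lemma bv_kernel_memLp:
  fixes p :: ereal and q :: real
  assumes pq: "1 < p" "1 \<le> q" "inverse p + ereal (1 / q) = 1"
    and \<phi>: "memLp p \<phi>" "\<forall>s\<in>{0..1}. 0 \<le> \<phi> s"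
    and k: "\<forall>t\<in>{0..1}. memLp (ereal q) (\<lambda>s. k t s)"
    and m: "memLp (ereal q) m" "\<forall>s\<in>{0..1}. 0 \<le> m s"
    and k_var: "AE s in lebesgue_on {0..1}.
      bounded_variation (\<lambda>t. k t s) 0 1 \<and> total_variation (\<lambda>t. k t s) 0 1 \<le> m s"
    and k_cont: "\<forall>\<tau>\<in>{0..1}. ((\<lambda>t. LINT s|lebesgue_on {0..1}. \<bar>k t s - k \<tau> s\<bar> * \<phi> s) \<longlongrightarrow> 0)
      (at \<tau> within {0..1})"
  shows "bv_kernel (lebesgue_on {0..1}) k \<phi> m"
proof
  show "k t \<in> borel_measurable (lebesgue_on {0..1})" if "t \<in> {0..1}" for t
    using k that by (simp add: memLp_def)
  show "m \<in> borel_measurable (lebesgue_on {0..1})"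
    using m by (simp add: memLp_def)
  show "integrable (lebesgue_on {0..1}) (\<lambda>s. k t s * \<phi> s)" if "t \<in> {0..1}" for t
    using memLp_mult_integrable[OF pq \<phi>(1)] k that by blast
  show "integrable (lebesgue_on {0..1}) (\<lambda>s. m s * \<phi> s)"
    by (rule memLp_mult_integrable[OF pq \<phi>(1) m(1)])
qed (use \<phi> m k_var k_cont in auto)

section \<open>Hammerstein equations with two functionals\<close>

locale hammerstein_equation = bv_kernel "lebesgue_on {0..1}" k \<phi> m
  for k :: "real \<Rightarrow> real \<Rightarrow> real" and \<phi> m :: "real \<Rightarrow> real" +
  fixes f :: "real \<Rightarrow> real \<Rightarrow> real" and \<gamma>\<^sub>1 \<gamma>\<^sub>2 :: "(real \<Rightarrow> real) \<Rightarrow> real"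
    and e\<^sub>1 e\<^sub>2 :: "real \<Rightarrow> real" and C R :: real
  assumes functionals_dual: "\<gamma>\<^sub>1 \<in> CBV_dual" "\<gamma>\<^sub>2 \<in> CBV_dual"
    and e_CBV: "e\<^sub>1 \<in> CBV" "e\<^sub>2 \<in> CBV"
    and R_nonneg: "0 \<le> R" and C_nonneg: "0 \<le> C"
    and f_measurable: "\<And>u. (\<lambda>s. f s u) \<in> borel_measurable (lebesgue_on {0..1})"
    and f_continuous: "AE s in lebesgue_on {0..1}. continuous_on UNIV (f s)"
    and f_dominated: "\<And>s u. s \<in> {0..1} \<Longrightarrow> \<bar>u\<bar> \<le> R \<Longrightarrow> \<bar>f s u\<bar> \<le> C * \<phi> s"
    and invariant: "dual_norm \<gamma>\<^sub>1 * R * BV_norm e\<^sub>1 + dual_norm \<gamma>\<^sub>2 * R * BV_norm e\<^sub>2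
      + C * weight_mass \<le> R"
begin

definition superposition :: "(real \<Rightarrow> real) \<Rightarrow> real \<Rightarrow> real" where
  "superposition x s = f s (x s)"

definition perturbed :: "real \<Rightarrow> real \<Rightarrow> (real \<Rightarrow> real) \<Rightarrow> real \<Rightarrow> real" where
  "perturbed a b y = (\<lambda>t. a * e\<^sub>1 t + b * e\<^sub>2 t + y t)"

definition solution_map ::
    "real \<times> real \<times> (real \<Rightarrow>\<^sub>C real) \<Rightarrow> real \<times> real \<times> (real \<Rightarrow>\<^sub>C real)" where
  "solution_map = (\<lambda>(a, b, Y).
    let y = int_op (superposition (perturbed a b Y)); x = perturbed a b y
    in (\<gamma>\<^sub>1 x, \<gamma>\<^sub>2 x, ext_bcontfun y 0 1))"

definition invariant_box :: "(real \<times> real \<times> (real \<Rightarrow>\<^sub>C real)) set" where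
  "invariant_box = cball 0 (dual_norm \<gamma>\<^sub>1 * R) \<times> cball 0 (dual_norm \<gamma>\<^sub>2 * R)
    \<times> cball 0 (C * weight_mass)"

definition compact_core :: "(real \<times> real \<times> (real \<Rightarrow>\<^sub>C real)) set" where
  "compact_core = cball 0 (dual_norm \<gamma>\<^sub>1 * R) \<times> cball 0 (dual_norm \<gamma>\<^sub>2 * R)
    \<times> closure ((\<lambda>y. ext_bcontfun y 0 1) ` int_op ` Collect (dominated C))"

lemma superposition_dominated:
  assumes x: "continuous_on {0..1} x" and bound: "\<And>s. s \<in> {0..1} \<Longrightarrow> \<bar>x s\<bar> \<le> R"
  shows "dominated C (superposition x)"
proof -
  have x_measurable: "x \<in> borel_measurable (lebesgue_on {0..1})"
    by (rule continuous_imp_measurable_on_sets_lebesgue[OF x]) simp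
  have "superposition x \<in> borel_measurable (lebesgue_on {0..1})"
    unfolding superposition_def[abs_def]
    by (rule complete_measure.borel_measurable_superposition[OF complete_measure_lebesgue_on
          f_measurable f_continuous x_measurable]) simp
  moreover have "\<bar>superposition x s\<bar> \<le> C * \<phi> s" if "s \<in> {0..1}" for s
    unfolding superposition_def by (rule f_dominated[OF that bound[OF that]])
  ultimately show ?thesis by (simp add: dominated_def)
qed

lemma superposition_tendsto:
  assumes "\<And>s. s \<in> {0..1} \<Longrightarrow> (\<lambda>n. X n s) \<longlonglongrightarrow> x s"
  shows "AE s in lebesgue_on {0..1}. (\<lambda>n. superposition (X n) s) \<longlonglongrightarrow> superposition x s"
  using f_continuous AE_space
proof eventually_elim
  case (elim s)
  then show ?case
    unfolding superposition_def using assms by (intro continuous_on_tendsto_compose[OF elim(1)]) auto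
qed

lemma perturbed_in_CBV: "y \<in> CBV \<Longrightarrow> perturbed a b y \<in> CBV"
  unfolding perturbed_def by (intro CBV_add CBV_cmult e_CBV)

lemma BV_norm_perturbed:
  assumes y: "y \<in> CBV"
  shows "BV_norm (perturbed a b y) \<le> \<bar>a\<bar> * BV_norm e\<^sub>1 + \<bar>b\<bar> * BV_norm e\<^sub>2 + BV_norm y"
proof -
  have "BV_norm (perturbed a b y) \<le> BV_norm (\<lambda>t. a * e\<^sub>1 t + b * e\<^sub>2 t) + BV_norm y"
    unfolding perturbed_def by (intro BV_norm_add CBV_add CBV_cmult e_CBV y)
  moreover have "BV_norm (\<lambda>t. a * e\<^sub>1 t + b * e\<^sub>2 t) \<le> BV_norm (\<lambda>t. a * e\<^sub>1 t) + BV_norm (\<lambda>t. b * e\<^sub>2 t)"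
    by (intro BV_norm_add CBV_cmult e_CBV)
  ultimately show ?thesis
    using BV_norm_cmult_le[OF e_CBV(1), of a] BV_norm_cmult_le[OF e_CBV(2), of b] by linarith
qed

lemma perturbed_tendsto:
  assumes a: "A \<longlonglongrightarrow> a" and b: "B \<longlonglongrightarrow> b" and in_CBV: "\<And>n. Y n \<in> CBV" "y \<in> CBV"
    and y: "(\<lambda>n. BV_norm (\<lambda>t. Y n t - y t)) \<longlonglongrightarrow> 0"
  shows "(\<lambda>n. BV_norm (\<lambda>t. perturbed (A n) (B n) (Y n) t - perturbed a b y t)) \<longlonglongrightarrow> 0"
proof (rule Lim_null_comparison)
  have diff: "(\<lambda>t. perturbed (A n) (B n) (Y n) t - perturbed a b y t)
      = perturbed (A n - a) (B n - b) (\<lambda>t. Y n t - y t)" for n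
    by (auto simp: perturbed_def algebra_simps)
  have "BV_norm (\<lambda>t. perturbed (A n) (B n) (Y n) t - perturbed a b y t)
      \<le> \<bar>A n - a\<bar> * BV_norm e\<^sub>1 + \<bar>B n - b\<bar> * BV_norm e\<^sub>2 + BV_norm (\<lambda>t. Y n t - y t)" for n
    unfolding diff by (intro BV_norm_perturbed CBV_diff in_CBV)
  moreover have "0 \<le> BV_norm (\<lambda>t. perturbed (A n) (B n) (Y n) t - perturbed a b y t)" for n
    by (intro BV_norm_nonneg CBV_diff perturbed_in_CBV in_CBV)
  ultimately show "\<forall>\<^sub>F n in sequentially.
      norm (BV_norm (\<lambda>t. perturbed (A n) (B n) (Y n) t - perturbed a b y t))
      \<le> \<bar>A n - a\<bar> * BV_norm e\<^sub>1 + \<bar>B n - b\<bar> * BV_norm e\<^sub>2 + BV_norm (\<lambda>t. Y n t - y t)"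
    by simp
  show "(\<lambda>n. \<bar>A n - a\<bar> * BV_norm e\<^sub>1 + \<bar>B n - b\<bar> * BV_norm e\<^sub>2 + BV_norm (\<lambda>t. Y n t - y t)) \<longlonglongrightarrow> 0"
    by (intro tendsto_add_zero tendsto_mult_left_zero tendsto_rabs_zero LIM_zero a b y)
qed

lemma invariant_box_coefficient_bounds:
  assumes "(a, b, Y) \<in> invariant_box"
    and "0 \<le> c\<^sub>1" "c\<^sub>1 \<le> BV_norm e\<^sub>1" "0 \<le> c\<^sub>2" "c\<^sub>2 \<le> BV_norm e\<^sub>2"
  shows "\<bar>a\<bar> * c\<^sub>1 + \<bar>b\<bar> * c\<^sub>2 + C * weight_mass \<le> R"
proof -
  have "\<bar>a\<bar> * c\<^sub>1 \<le> dual_norm \<gamma>\<^sub>1 * R * BV_norm e\<^sub>1" "\<bar>b\<bar> * c\<^sub>2 \<le> dual_norm \<gamma>\<^sub>2 * R * BV_norm e\<^sub>2"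
    using assms R_nonneg functionals_dual
    by (auto simp: invariant_box_def dist_real_def intro!: mult_mono dual_norm_nonneg)
  then show ?thesis using invariant by simp
qed

lemma superposition_invariant_box_dominated:
  assumes "(a, b, Y) \<in> invariant_box"
  shows "dominated C (superposition (perturbed a b Y))"
proof (rule superposition_dominated)
  show "continuous_on {0..1} (perturbed a b Y)"
    unfolding perturbed_def using e_CBV by (intro continuous_intros) (simp_all add: CBV_def)
  fix s
  have "\<bar>perturbed a b Y s\<bar> \<le> \<bar>a\<bar> * \<bar>e\<^sub>1 s\<bar> + \<bar>b\<bar> * \<bar>e\<^sub>2 s\<bar> + C * weight_mass"
    using norm_bounded[of Y s] assms abs_triangle_ineq[of "a * e\<^sub>1 s + b * e\<^sub>2 s" "Y s"]
      abs_triangle_ineq[of "a * e\<^sub>1 s" "b * e\<^sub>2 s"]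
    by (simp add: perturbed_def invariant_box_def abs_mult)
  also have "\<dots> \<le> R"
    using invariant_box_coefficient_bounds[OF assms] abs_le_BV_norm e_CBV by simp
  finally show "\<bar>perturbed a b Y s\<bar> \<le> R" .
qed

lemma compact_compact_core: "compact compact_core"
proof -
  have "compact (closure ((\<lambda>y. ext_bcontfun y 0 1) ` int_op ` Collect (dominated C)))"
    by (rule compact_closure_ext_bcontfun[where B = "C * weight_mass"])
      (use equicontinuous_on_int_op abs_int_op_le in auto)
  then show ?thesis
    unfolding compact_core_def by (intro compact_Times compact_cball)
qed

lemma compact_core_subset_invariant_box: "compact_core \<subseteq> invariant_box"
proof -
  have "norm (ext_bcontfun (int_op g) 0 1) \<le> C * weight_mass" if "dominated C g" for g
  proof (rule norm_bound)
    show "norm (ext_bcontfun (int_op g) 0 1 t) \<le> C * weight_mass" for t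
      using int_op_continuous_on[OF that] abs_int_op_le[OF that] by (simp add: ext_bcontfun_apply)
  qed
  then have "closure ((\<lambda>y. ext_bcontfun y 0 1) ` int_op ` Collect (dominated C))
      \<subseteq> cball 0 (C * weight_mass)"
    by (intro closure_minimal) auto
  then show ?thesis
    unfolding compact_core_def invariant_box_def by (intro Sigma_mono) auto
qed

lemma solution_map_in_compact_core: "solution_map \<in> invariant_box \<rightarrow> compact_core"
proof
  fix c assume "c \<in> invariant_box"
  then obtain a b Y where c_eq: "c = (a, b, Y)" and box: "(a, b, Y) \<in> invariant_box"
    by (cases c) auto
  define g where "g = superposition (perturbed a b Y)"
  define x where "x = perturbed a b (int_op g)"
  have g: "dominated C g"
    unfolding g_def by (rule superposition_invariant_box_dominated[OF box])
  have x: "x \<in> CBV"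
    unfolding x_def by (rule perturbed_in_CBV[OF int_op_in_CBV[OF g]])
  have "BV_norm x \<le> \<bar>a\<bar> * BV_norm e\<^sub>1 + \<bar>b\<bar> * BV_norm e\<^sub>2 + BV_norm (int_op g)"
    unfolding x_def by (rule BV_norm_perturbed[OF int_op_in_CBV[OF g]])
  also have "\<dots> \<le> \<bar>a\<bar> * BV_norm e\<^sub>1 + \<bar>b\<bar> * BV_norm e\<^sub>2 + C * weight_mass"
    using BV_norm_int_op_le[OF g] by simp
  also have "\<dots> \<le> R"
    by (intro invariant_box_coefficient_bounds[OF box] BV_norm_nonneg e_CBV order_refl)
  finally have x_norm: "BV_norm x \<le> R" .
  have "\<bar>\<gamma> x\<bar> \<le> dual_norm \<gamma> * R" if "\<gamma> \<in> CBV_dual" for \<gamma>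
    using dual_norm_bound[OF that x] mult_left_mono[OF x_norm dual_norm_nonneg[OF that]]
    by (rule order_trans)
  then show "solution_map c \<in> compact_core"
    unfolding c_eq using functionals_dual g
    by (auto simp: solution_map_def compact_core_def Let_def simp flip: g_def x_def
        intro!: subsetD[OF closure_subset])
qed

lemma ext_bcontfun_int_op_tendsto:
  assumes G: "\<And>n. dominated C (G n)" and g: "dominated C g"
    and lim: "(\<lambda>n. BV_norm (\<lambda>t. int_op (G n) t - int_op g t)) \<longlonglongrightarrow> 0"
  shows "(\<lambda>n. ext_bcontfun (int_op (G n)) 0 1) \<longlonglongrightarrow> ext_bcontfun (int_op g) 0 1"
  unfolding tendsto_dist_iff[of "\<lambda>n. ext_bcontfun (int_op (G n)) 0 1"]
proof (rule Lim_null_comparison[OF _ lim])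
  have "dist (ext_bcontfun (int_op (G n)) 0 1) (ext_bcontfun (int_op g) 0 1)
      \<le> BV_norm (\<lambda>t. int_op (G n) t - int_op g t)" for n
    using abs_le_BV_norm[OF CBV_diff[OF int_op_in_CBV[OF G] int_op_in_CBV[OF g]]]
      int_op_continuous_on[OF G] int_op_continuous_on[OF g]
    by (intro dist_ext_bcontfun_le) (simp_all add: dist_real_def)
  then show "\<forall>\<^sub>F n in sequentially.
      norm (dist (ext_bcontfun (int_op (G n)) 0 1) (ext_bcontfun (int_op g) 0 1))
      \<le> BV_norm (\<lambda>t. int_op (G n) t - int_op g t)"
    by simp
qed

lemma solution_map_continuous_on: "continuous_on invariant_box solution_map"
proof (rule continuous_on_sequentiallyI)
  fix U u assume U: "\<forall>n. U n \<in> invariant_box" and u: "u \<in> invariant_box" and lim: "U \<longlonglongrightarrow> u"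
  obtain a b Y where u_eq: "u = (a, b, Y)" by (cases u)
  define A where "A n = fst (U n)" for n
  define B where "B n = fst (snd (U n))" for n
  define V where "V n = snd (snd (U n))" for n
  have U_eq: "U n = (A n, B n, V n)" for n
    by (simp add: A_def B_def V_def)
  have A: "A \<longlonglongrightarrow> a" and B: "B \<longlonglongrightarrow> b" and V: "V \<longlonglongrightarrow> Y"
    using tendsto_fst[OF lim] tendsto_fst[OF tendsto_snd[OF lim]] tendsto_snd[OF tendsto_snd[OF lim]]
    by (simp_all add: u_eq U_eq)
  define g where "g = superposition (perturbed a b Y)"
  define G where "G n = superposition (perturbed (A n) (B n) (V n))" for n
  have g: "dominated C g" and G: "dominated C (G n)" for n
    using U u superposition_invariant_box_dominated by (simp_all add: g_def G_def u_eq U_eq)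
  have "(\<lambda>n. perturbed (A n) (B n) (V n) s) \<longlonglongrightarrow> perturbed a b Y s" for s
    unfolding perturbed_def
    by (intro tendsto_intros A B tendsto_uniform_limitI[OF tendsto_bcontfun_uniform_limit[OF V]]) simp
  then have "AE s in lebesgue_on {0..1}. (\<lambda>n. G n s) \<longlonglongrightarrow> g s"
    unfolding g_def G_def by (rule superposition_tendsto)
  then have int_lim: "(\<lambda>n. BV_norm (\<lambda>t. int_op (G n) t - int_op g t)) \<longlonglongrightarrow> 0"
    by (rule int_op_tendsto[OF G g])
  have "(\<lambda>n. \<gamma> (perturbed (A n) (B n) (int_op (G n)))) \<longlonglongrightarrow> \<gamma> (perturbed a b (int_op g))"
    if "\<gamma> \<in> CBV_dual" for \<gamma>
    by (intro CBV_dual_tendsto[OF that] perturbed_in_CBV perturbed_tendsto int_op_in_CBV[OF G]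
        int_op_in_CBV[OF g] A B int_lim)
  moreover have "(\<lambda>n. ext_bcontfun (int_op (G n)) 0 1) \<longlonglongrightarrow> ext_bcontfun (int_op g) 0 1"
    by (rule ext_bcontfun_int_op_tendsto[OF G g int_lim])
  ultimately show "(\<lambda>n. solution_map (U n)) \<longlonglongrightarrow> solution_map u"
    using functionals_dual
    by (auto simp: solution_map_def u_eq U_eq g_def G_def Let_def intro!: tendsto_Pair)
qed

theorem solution_exists:
  obtains x where "x \<in> CBV"
    and "\<And>t. t \<in> {0..1} \<Longrightarrow> x t = \<gamma>\<^sub>1 x * e\<^sub>1 t + \<gamma>\<^sub>2 x * e\<^sub>2 t
      + (LINT s|lebesgue_on {0..1}. k t s * f s (x s))"
proof -
  have "convex invariant_box"
    unfolding invariant_box_def by (intro convex_Times convex_cball)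
  moreover have "0 \<in> invariant_box"
    using R_nonneg functionals_dual C_nonneg weight_mass_nonneg
    by (simp add: invariant_box_def dual_norm_nonneg zero_prod_def)
  ultimately obtain c where c: "c \<in> invariant_box" "solution_map c = c"
    using schauder_fixed_point[OF _ _ compact_compact_core compact_core_subset_invariant_box
        solution_map_in_compact_core solution_map_continuous_on] by blast
  obtain a b Y where c_eq: "c = (a, b, Y)" by (cases c)
  define g where "g = superposition (perturbed a b Y)"
  define x where "x = perturbed a b (int_op g)"
  have g: "dominated C g"
    using superposition_invariant_box_dominated c(1) by (simp add: g_def c_eq)
  have fixed: "a = \<gamma>\<^sub>1 x" "b = \<gamma>\<^sub>2 x" "Y = ext_bcontfun (int_op g) 0 1"
    using c(2) by (simp_all add: c_eq solution_map_def Let_def x_def g_def)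
  have "x s = perturbed a b Y s" if "s \<in> {0..1}" for s
    using that int_op_continuous_on[OF g] by (simp add: x_def perturbed_def fixed(3) ext_bcontfun_apply)
  then have "int_op g = int_op (superposition x)"
    unfolding int_op_def g_def superposition_def
    by (intro ext if_cong refl Bochner_Integration.integral_cong) auto
  then have "x t = \<gamma>\<^sub>1 x * e\<^sub>1 t + \<gamma>\<^sub>2 x * e\<^sub>2 t + int_op (superposition x) t" for t
    using fun_cong[OF x_def[unfolded perturbed_def], of t] by (simp flip: fixed(1,2))
  moreover have "x \<in> CBV"
    unfolding x_def by (rule perturbed_in_CBV[OF int_op_in_CBV[OF g]])
  ultimately show thesis
    using that[of x] by (simp add: int_op_def superposition_def)
qed

end

lemma sublinear_growth_invariant_radius:
  fixes \<psi> :: "real \<Rightarrow> real"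
  assumes lim: "((\<lambda>r. \<psi> r / r) \<longlongrightarrow> 0) at_top" and \<theta>: "\<theta> < 1"
  obtains R where "0 < R" "\<theta> * R + \<psi> R * W \<le> R"
proof -
  have "((\<lambda>r. \<psi> r / r * W) \<longlongrightarrow> 0) at_top"
    using tendsto_mult_left_zero[OF lim] .
  then have "\<forall>\<^sub>F r in at_top. \<psi> r / r * W < 1 - \<theta>"
    using \<theta> by (intro order_tendstoD) auto
  then have "\<forall>\<^sub>F r in at_top. \<psi> r / r * W < 1 - \<theta> \<and> 0 < r"
    using eventually_gt_at_top[of 0] by (rule eventually_conj)
  then obtain R where R: "0 < R" "\<psi> R / R * W < 1 - \<theta>"
    using eventually_happens' trivial_limit_at_top_linorder by blast
  then have "\<psi> R * W \<le> (1 - \<theta>) * R"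
    by (simp add: field_simps)
  then show thesis
    by (intro that[OF R(1)]) (simp add: left_diff_distrib)
qed

lemma mono_growth_bound:
  fixes \<psi> :: "real \<Rightarrow> real"
  assumes \<psi>: "mono_on {0..} \<psi>" and c: "0 \<le> c" and y: "\<bar>y\<bar> \<le> c * \<psi> \<bar>u\<bar>" and u: "\<bar>u\<bar> \<le> R"
  shows "\<bar>y\<bar> \<le> \<psi> R * c"
proof -
  have "\<psi> \<bar>u\<bar> \<le> \<psi> R"
    using u by (intro mono_onD[OF \<psi>]) auto
  with c have "c * \<psi> \<bar>u\<bar> \<le> c * \<psi> R"
    by (rule mult_left_mono[rotated])
  with y show ?thesis by (simp add: mult.commute)
qed

theorem theorem4p9:
  fixes \<alpha> \<beta> :: "(real \<Rightarrow> real) \<Rightarrow> real"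
    and v w :: "real \<Rightarrow> real"
    and p :: ereal and q :: real
    and f :: "real \<Rightarrow> real \<Rightarrow> real"
    and \<psi> \<phi> :: "real \<Rightarrow> real"
    and k :: "real \<Rightarrow> real \<Rightarrow> real"
    and m :: "real \<Rightarrow> real"
  assumes alpha: "\<alpha> \<in> CBV_dual" and beta: "\<beta> \<in> CBV_dual"
    and v: "v \<in> CBV" and w: "w \<in> CBV"
    and vw: "\<forall>t\<in>{0..1}. v t + w t = 1"
    and small: "dual_norm \<alpha> + dual_norm (\<lambda>x. \<alpha> x - \<beta> x) * BV_norm w < 1"
    and p: "1 < p" and q: "1 \<le> q"
    and pq: "inverse p + ereal (1 / q) = 1"
    and f_meas: "\<forall>u. (\<lambda>t. f t u) \<in> borel_measurable (lebesgue_on {0..1})"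
    and f_cont: "AE t in lebesgue_on {0..1}. continuous_on UNIV (\<lambda>u. f t u)"
    and psi_mono: "mono_on {0..} \<psi>"
    and psi_nonneg: "\<forall>r\<ge>0. 0 \<le> \<psi> r"
    and phi_Lp: "memLp p \<phi>"
    and phi_nonneg: "\<forall>t\<in>{0..1}. 0 \<le> \<phi> t"
    and f_bound: "\<forall>t\<in>{0..1}. \<forall>u. \<bar>f t u\<bar> \<le> \<phi> t * \<psi> \<bar>u\<bar>"
    and psi_lim: "((\<lambda>r. \<psi> r / r) \<longlongrightarrow> 0) at_top"
    and k_Lq: "\<forall>t\<in>{0..1}. memLp (ereal q) (\<lambda>s. k t s)"
    and m_Lq: "memLp (ereal q) m"
    and m_nonneg: "\<forall>s\<in>{0..1}. 0 \<le> m s"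
    and k_var: "AE s in lebesgue_on {0..1}.
                  bounded_variation (\<lambda>t. k t s) 0 1 \<and> total_variation (\<lambda>t. k t s) 0 1 \<le> m s"
    and k_cont: "\<forall>\<tau>\<in>{0..1}. ((\<lambda>t. integral\<^sup>L (lebesgue_on {0..1}) (\<lambda>s. \<bar>k t s - k \<tau> s\<bar> * \<phi> s))
                    \<longlongrightarrow> 0) (at \<tau> within {0..1})"
  shows "\<exists>x\<in>CBV. \<forall>t\<in>{0..1}.
           x t = \<alpha> x * v t + \<beta> x * w t + integral\<^sup>L (lebesgue_on {0..1}) (\<lambda>s. k t s * f s (x s))"
proof -
  interpret kernel: bv_kernel "lebesgue_on {0..1}" k \<phi> m
    by (rule bv_kernel_memLp[OF p q pq phi_Lp phi_nonneg k_Lq m_Lq m_nonneg k_var k_cont])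
  obtain R where R: "0 < R" and invariant:
    "(dual_norm \<alpha> + dual_norm (\<lambda>x. \<alpha> x - \<beta> x) * BV_norm w) * R + \<psi> R * kernel.weight_mass \<le> R"
    by (rule sublinear_growth_invariant_radius[OF psi_lim small])
  interpret equation: hammerstein_equation k \<phi> m f \<alpha> "\<lambda>x. \<beta> x - \<alpha> x" "indicator {0..1}" w "\<psi> R" R
  proof
    show "\<bar>f s u\<bar> \<le> \<psi> R * \<phi> s" if "s \<in> {0..1}" "\<bar>u\<bar> \<le> R" for s u
      using that phi_nonneg f_bound by (intro mono_growth_bound[OF psi_mono]) auto
    show "dual_norm \<alpha> * R * BV_norm (indicator {0..1}) + dual_norm (\<lambda>x. \<beta> x - \<alpha> x) * R * BV_norm w
        + \<psi> R * kernel.weight_mass \<le> R"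
      using invariant by (simp add: BV_norm_indicator dual_norm_minus_commute[of \<beta> \<alpha>] algebra_simps)
  qed (use alpha diff_in_CBV_dual[OF beta alpha] indicator_in_CBV w R f_meas f_cont psi_nonneg
      in simp_all)
  obtain x where x: "x \<in> CBV"
    and eq: "\<And>t. t \<in> {0..1} \<Longrightarrow> x t = \<alpha> x * indicator {0..1} t + (\<beta> x - \<alpha> x) * w t
      + (LINT s|lebesgue_on {0..1}. k t s * f s (x s))"
    by (rule equation.solution_exists) (rule that)
  have "x t = \<alpha> x * v t + \<beta> x * w t + (LINT s|lebesgue_on {0..1}. k t s * f s (x s))"
    if t: "t \<in> {0..1}" for t
  proof -
    have v_eq: "v t = 1 - w t" using vw t by (simp add: eq_diff_eq)
    show ?thesis unfolding v_eq using eq[OF t] t by (simp add: algebra_simps)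
  qed
  with x show ?thesis by blast
qed

end
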